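(* Assume the standing assumptions of the context and that $\Delta\ne0$. Then for every $\varepsilon>0$, as $H\to\infty$ (uniformly in $N\ge1$), $$\sum_{|n|\le N}\Big|\sum_{H\le q<2H}\mathfrak{S}_q(n)\Big|^2\ \ll_\varepsilon\ H^\varepsilon\Big(H+\frac{N}{H^{1/2}}\Big).$$
   Context: Standing assumptions: $\Gamma<\mathrm{SL}_2(\mathbb{Z})$ is Zariski dense in $\mathrm{SL}_2$ and contains $\begin{pmatrix}1&P\\0&1\end{pmatrix}$ for a fixed positive integer $P$. $A,B,C,D$ are fixed nonzero integers with $\gcd(A,B,C,D)=1$; for $\gamma=\begin{pmatrix}a&b\\c&d\end{pmatrix}$, $\mathscr{L}(\gamma)=Aa+Bb+Cc+Dd$, and $\Delta=AD-BC$. $\Gamma(q)=\{\gamma\in\Gamma:\gamma\equiv I\pmod q\}$. (1) For coprime $q_1,q_2$ the natural map $\Gamma/\Gamma(q_1q_2)\to\Gamma/\Gamma(q_1)\times\Gamma/\Gamma(q_2)$ is bijective. (2) There is a finite set of "bad" primes, containing $2$; every other prime $p$ ("good") has $\Gamma\to\mathrm{SL}_2(\mathbb{Z}/p^\ell\mathbb{Z})$ surjective for all $\ell\ge1$. (3) For each bad prime $p$ there is $k_p\ge1$ such that every element of $\Gamma$ is $\equiv I \pmod{p^{k_p}}$, for $\ell>k_p$ the image of $\Gamma$ mod $p^\ell$ is exactly the set of elements of $\mathrm{SL}_2(\mathbb{Z}/p^\ell\mathbb{Z})$ congruent to $I$ mod $p^{k_p}$, $P\equiv0\pmod{p^{k_p}}$,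 and $k_p>L_{p}$ where $p^{L_p}\|B$. The Ramanujan sum is $c_q(x)=\sum_{r\bmod q,(r,q)=1}e^{2\pi irx/q}$ and $\mathfrak{S}_q(n)=\frac1{[\Gamma:\Gamma(q)]}\sum_{\gamma\in\Gamma(q)\backslash\Gamma}c_q(\mathscr{L}(\gamma)-n)$. Implied constants may depend on $\varepsilon$, $\Gamma$, $P$ and $A,B,C,D$. *)

theory Defs
  imports
    "HOL-Analysis.Analysis"
    "HOL-Algebra.Coset"
    "HOL-Number_Theory.Cong"
begin

type_synonym mat2 = "int ^ 2 ^ 2"

definition SL2Z :: "mat2 monoid" where
  "SL2Z = \<lparr>carrier = {M. det M = 1}, monoid.mult = (**), one = mat 1\<rparr>"

abbreviation grp :: "mat2 set \<Rightarrow> mat2 monoid" where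
  "grp \<Gamma> \<equiv> SL2Z\<lparr>carrier := \<Gamma>\<rparr>"

inductive poly_fun :: "(complex ^ 2 ^ 2 \<Rightarrow> complex) \<Rightarrow> bool" where
  const: "poly_fun (\<lambda>_. c)"
| coord: "poly_fun (\<lambda>M. M $ i $ j)"
| add: "poly_fun f \<Longrightarrow> poly_fun g \<Longrightarrow> poly_fun (\<lambda>M. f M + g M)"
| mult: "poly_fun f \<Longrightarrow> poly_fun g \<Longrightarrow> poly_fun (\<lambda>M. f M * g M)"

text \<open>Zariski density in the algebraic group \<open>SL\<^sub>2\<close>, identified with its complex points: every
  polynomial in the four matrix entries that vanishes on \<open>\<Gamma>\<close> vanishes on \<open>SL\<^sub>2(\<complex>)\<close>.\<close>

definition zariski_dense_SL2 :: "mat2 set \<Rightarrow> bool" where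
  "zariski_dense_SL2 \<Gamma> \<longleftrightarrow>
     (\<forall>f. poly_fun f \<longrightarrow> (\<forall>\<gamma>\<in>\<Gamma>. f (\<chi> i j. of_int (\<gamma> $ i $ j)) = 0) \<longrightarrow>
          (\<forall>M. det M = 1 \<longrightarrow> f M = 0))"

definition mat_cong :: "nat \<Rightarrow> mat2 \<Rightarrow> mat2 \<Rightarrow> bool" where
  "mat_cong q M M' \<longleftrightarrow> (\<forall>i j. [M $ i $ j = M' $ i $ j] (mod int q))"

definition cong_sub :: "mat2 set \<Rightarrow> nat \<Rightarrow> mat2 set" where
  "cong_sub \<Gamma> q = {\<gamma> \<in> \<Gamma>. mat_cong q \<gamma> (mat 1)}"

text \<open>\<open>SL\<^sub>2(\<int>/q\<int>)\<close>, with \<open>\<int>/q\<int>\<close> represented by the residues \<open>0, \<dots>, q - 1\<close>, and the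
  reduction map onto these representatives.\<close>

definition SL2_mod :: "nat \<Rightarrow> mat2 set" where
  "SL2_mod q = {M. (\<forall>i j. M $ i $ j \<in> {0..<int q}) \<and> [det M = 1] (mod int q)}"

definition reduce :: "nat \<Rightarrow> mat2 \<Rightarrow> mat2" where
  "reduce q M = (\<chi> i j. M $ i $ j mod int q)"

text \<open>The quotients \<open>\<Gamma>/\<Gamma>(q)\<close> are the quotient groups \<open>grp \<Gamma> Mod cong_sub \<Gamma> q\<close>. Since
  \<open>\<Gamma>(q\<^sub>1q\<^sub>2) \<subseteq> \<Gamma>(q\<^sub>i)\<close>, the natural map sends a coset \<open>K\<close> of \<open>\<Gamma>(q\<^sub>1q\<^sub>2)\<close> to the product
  sets \<open>\<Gamma>(q\<^sub>i) K\<close>, i.e. to the cosets of \<open>\<Gamma>(q\<^sub>i)\<close> containing it.\<close>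

definition natural_map ::
    "mat2 set \<Rightarrow> nat \<Rightarrow> nat \<Rightarrow> mat2 set \<Rightarrow> mat2 set \<times> mat2 set" where
  "natural_map \<Gamma> q\<^sub>1 q\<^sub>2 K =
     (cong_sub \<Gamma> q\<^sub>1 <#>\<^bsub>grp \<Gamma>\<^esub> K, cong_sub \<Gamma> q\<^sub>2 <#>\<^bsub>grp \<Gamma>\<^esub> K)"

definition lin_form :: "int \<Rightarrow> int \<Rightarrow> int \<Rightarrow> int \<Rightarrow> mat2 \<Rightarrow> int" where
  "lin_form A B C D \<gamma> = A * \<gamma> $ 1 $ 1 + B * \<gamma> $ 1 $ 2 + C * \<gamma> $ 2 $ 1 + D * \<gamma> $ 2 $ 2"

definition ramanujan_sum :: "nat \<Rightarrow> int \<Rightarrow> complex" where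
  "ramanujan_sum q x =
     (\<Sum>r | r < q \<and> coprime r q. exp (2 * of_real pi * \<i> * of_nat r * of_int x / of_nat q))"

text \<open>The summand does not depend on the representative chosen in each coset of \<open>\<Gamma>(q)\<close>; see
  \<open>ramanujan_sum_lin_form_coset\<close> below.\<close>

definition sing_series :: "mat2 set \<Rightarrow> int \<Rightarrow> int \<Rightarrow> int \<Rightarrow> int \<Rightarrow> nat \<Rightarrow> int \<Rightarrow> complex" where
  "sing_series \<Gamma> A B C D q n =
     (\<Sum>K \<in> rcosets\<^bsub>grp \<Gamma>\<^esub> cong_sub \<Gamma> q.
        ramanujan_sum q (lin_form A B C D (SOME \<gamma>. \<gamma> \<in> K) - n))
     / of_nat (card (rcosets\<^bsub>grp \<Gamma>\<^esub> cong_sub \<Gamma> q))"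

lemma ramanujan_sum_cong:
  assumes "[x = y] (mod int q)" "q > 0"
  shows "ramanujan_sum q x = ramanujan_sum q y"
proof -
  obtain t where t: "x = y + int q * t"
    using assms(1) by (metis cong_iff_lin cong_sym)
  show ?thesis
    unfolding ramanujan_sum_def
  proof (rule sum.cong[OF refl])
    fix r
    have "2 * of_real pi * \<i> * of_nat r * of_int x / of_nat q =
        2 * of_real pi * \<i> * of_nat r * of_int y / of_nat q
          + complex_of_real (of_int (2 * (int r * t)) * pi) * \<i>"
      using assms(2) by (simp add: t field_simps)
    then show "exp (2 * of_real pi * \<i> * of_nat r * of_int x / of_nat q) =
        exp (2 * of_real pi * \<i> * of_nat r * of_int y / of_nat q)"
      unfolding exp_eq by blast
  qed
qed

lemma group_SL2Z: "group SL2Z"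
proof (rule groupI)
  fix M assume M: "M \<in> carrier SL2Z"
  define W :: mat2 where
    "W = vector [vector [M $ 2 $ 2, - (M $ 1 $ 2)], vector [- (M $ 2 $ 1), M $ 1 $ 1]]"
  have d: "M $ 1 $ 1 * M $ 2 $ 2 - M $ 1 $ 2 * M $ 2 $ 1 = 1"
    using M by (simp add: SL2Z_def det_2)
  have "W ** M = mat 1"
    using d by (simp add: vec_eq_iff forall_2 W_def matrix_matrix_mult_def sum_2 mat_def algebra_simps)
  moreover have "det W = 1"
    using d by (simp add: W_def det_2 algebra_simps)
  ultimately show "\<exists>W\<in>carrier SL2Z. W \<otimes>\<^bsub>SL2Z\<^esub> M = \<one>\<^bsub>SL2Z\<^esub>"
    by (auto simp: SL2Z_def)
qed (auto simp: SL2Z_def det_mul matrix_mul_assoc)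

lemma ramanujan_sum_lin_form_coset:
  assumes "subgroup \<Gamma> SL2Z" "q > 0" "K \<in> rcosets\<^bsub>grp \<Gamma>\<^esub> cong_sub \<Gamma> q" "\<gamma> \<in> K" "\<gamma>' \<in> K"
  shows "ramanujan_sum q (lin_form A B C D \<gamma> - n) = ramanujan_sum q (lin_form A B C D \<gamma>' - n)"
proof -
  obtain g where "K = cong_sub \<Gamma> q #>\<^bsub>grp \<Gamma>\<^esub> g"
    using assms(3) by (auto simp: RCOSETS_def)
  then have *: "\<exists>h. mat_cong q h (mat 1) \<and> x = h ** g" if "x \<in> K" for x
    using that by (auto simp: r_coset_def SL2Z_def cong_sub_def)
  have **: "[x $ i $ j = g $ i $ j] (mod int q)" if "x \<in> K" for x i j
  proof -
    obtain h where h: "mat_cong q h (mat 1)" "x = h ** g"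
      using * \<open>x \<in> K\<close> by blast
    have "[(\<Sum>k\<in>UNIV. h $ i $ k * g $ k $ j) = (\<Sum>k\<in>UNIV. mat 1 $ i $ k * g $ k $ j)] (mod int q)"
      using h(1) by (intro cong_sum cong_mult) (auto simp: mat_cong_def)
    moreover have "(\<Sum>k\<in>UNIV. mat 1 $ i $ k * g $ k $ j) = (mat 1 ** g) $ i $ j"
      by (simp add: matrix_matrix_mult_def)
    ultimately show ?thesis
      using h(2) by (simp add: matrix_matrix_mult_def[of h g])
  qed
  have "[lin_form A B C D x - n = lin_form A B C D g - n] (mod int q)" if "x \<in> K" for x
    unfolding lin_form_def using that by (intro cong_diff cong_add cong_mult cong_refl **)
  then show ?thesis
    using assms(2,4,5) ramanujan_sum_cong by metis
qed

end

theory Submission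
  imports Defs "HOL-Real_Asymp.Real_Asymp"
begin

text \<open>
  Write \<open>F\<^sub>q(r)\<close> for the average of \<open>e(r L(\<gamma>) / q)\<close> over the image of \<open>\<Gamma>\<close> modulo \<open>q\<close>. Then
  \<open>\<SS>\<^sub>q(n)\<close> is the sum of \<open>F\<^sub>q(r) e(- n r / q)\<close> over the units \<open>r\<close> modulo \<open>q\<close>. The fractions
  \<open>r / q\<close> with \<open>H \<le> q < 2 H\<close> are \<open>1 / (4 H\<^sup>2)\<close>-separated, so a large sieve inequality (a
  logarithmic loss is harmless) bounds the left-hand side by \<open>(N + H\<^sup>2) H\<^sup>\<epsilon>\<close> times the sum of the
  energies \<open>T(q) = \<Sum>\<^sub>r |F\<^sub>q(r)|\<^sup>2\<close>, and it suffices that \<open>T(q)\<close> is at most \<open>q\<close> to the power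
  \<open>- 2 + \<epsilon>\<close>.

  The energy is submultiplicative by hypothesis (1), so only prime powers matter. Left translation
  by a unipotent element with upper right entry \<open>s\<close> changes \<open>L\<close> by \<open>s (A c + B d)\<close> and fixes
  \<open>A c + B d\<close>; hence only matrices with \<open>r s (A c + B d) \<equiv> 0\<close> contribute. At a bad prime
  \<open>A c + B d \<equiv> B\<close> is nonzero modulo \<open>p\<close> to the power \<open>k\<^sub>p\<close>, so high powers of \<open>p\<close> have energy \<open>0\<close>.
  At a good prime (\<open>s = 1\<close>), \<open>F\<^sub>q\<close> becomes a normalised Kloosterman sum, whose mean square over
  \<open>r\<close> is computed by Parseval, i.e. by counting solutions of \<open>(x - y) (x y - \<Delta>) \<equiv> 0\<close>; no pointwise
  bound for Kloosterman sums is required. This even gives \<open>N / H\<close> in place of \<open>N / H\<^bsup>1/2\<^esup>\<close>.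
\<close>

section \<open>Additive characters and the large sieve\<close>

definition ee :: "real \<Rightarrow> complex" where "ee x = cis (2 * pi * x)"

lemma ee_add: "ee (x + y) = ee x * ee y"
  by (simp add: ee_def cis_mult distrib_left)

lemma norm_ee [simp]: "norm (ee x) = 1"
  by (simp add: ee_def)

lemma ee_of_int [simp]: "ee (of_int m) = 1"
  by (simp add: ee_def complex_eq_iff cos_int_2pin sin_int_2pin)

lemma cnj_ee: "cnj (ee x) = ee (- x)"
  by (simp add: ee_def cis_cnj)

lemma ee_add_int: "ee (x + of_int m) = ee x"
  by (simp add: ee_add)

lemma ee_power: "ee x ^ n = ee (real n * x)"
  by (simp add: ee_def Complex.DeMoivre mult_ac)

lemma ee_eq_1_iff: "ee x = 1 \<longleftrightarrow> x \<in> \<int>"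
proof
  assume "ee x = 1"
  then have "cos (2 * pi * x) = 1"
    by (simp add: ee_def complex_eq_iff)
  then obtain m :: int where "2 * pi * x = of_int m * 2 * pi"
    unfolding cos_one_2pi_int by auto
  then show "x \<in> \<int>" by simp
qed (auto elim: Ints_cases)

lemma ee_cong:
  assumes "[x = y] (mod int q)" "q > 0"
  shows "ee (of_int x / of_nat q) = ee (of_int y / of_nat q)"
proof -
  obtain t where t: "x = y + int q * t"
    using assms(1) by (metis cong_iff_lin cong_sym)
  have "of_int x / real q = of_int y / real q + of_int t"
    using assms(2) by (simp add: t field_simps)
  then show ?thesis by (simp add: ee_add)
qed

lemma ee_divide_eq_1_iff:
  assumes "q > 0"
  shows "ee (of_int x / of_nat q) = 1 \<longleftrightarrow> int q dvd x"
proof -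
  have "of_int x / real q \<in> \<int> \<longleftrightarrow> int q dvd x"
  proof
    assume "of_int x / real q \<in> \<int>"
    then obtain m where "of_int x / real q = of_int m" by (auto elim: Ints_cases)
    then have "real_of_int x = of_int (int q * m)" using assms by (simp add: field_simps)
    then show "int q dvd x" by (metis dvd_triv_left of_int_eq_iff)
  qed (use assms in auto)
  then show ?thesis by (simp add: ee_eq_1_iff)
qed

lemma sum_ee_residues:
  assumes "q > 0"
  shows "(\<Sum>r<q. ee (of_int (int r * x) / of_nat q)) = (if int q dvd x then of_nat q else 0)"
proof -
  define z where "z = ee (of_int x / of_nat q)"
  have z: "ee (of_int (int r * x) / of_nat q) = z ^ r" for r
    by (simp add: z_def ee_power)
  have "z ^ q = 1"
    using assms by (simp add: z_def ee_power)
  then show ?thesis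
    unfolding z using assms ee_divide_eq_1_iff[OF assms, of x]
    by (auto simp: z_def[symmetric] sum_gp_strict)
qed

lemma norm_sum_square:
  "complex_of_real ((norm (\<Sum>x\<in>X. f x))\<^sup>2) = (\<Sum>x\<in>X. \<Sum>y\<in>X. f x * cnj (f y))"
  by (subst complex_norm_square) (simp add: sum_product)

lemma parseval_residues:
  assumes "q > 0" "finite X"
  shows "(\<Sum>r<q. (norm (\<Sum>x\<in>X. ee (of_int (int r * f x) / of_nat q)))\<^sup>2)
    = real q * real (card {(x, y) \<in> X \<times> X. int q dvd f x - f y})"
proof -
  have "complex_of_real (\<Sum>r<q. (norm (\<Sum>x\<in>X. ee (of_int (int r * f x) / of_nat q)))\<^sup>2)
      = (\<Sum>r<q. \<Sum>x\<in>X. \<Sum>y\<in>X. ee (of_int (int r * (f x - f y)) / of_nat q))"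
    unfolding of_real_sum norm_sum_square
    by (simp add: cnj_ee ee_add[symmetric] algebra_simps diff_divide_distrib)
  also have "\<dots> = (\<Sum>x\<in>X. \<Sum>y\<in>X. \<Sum>r<q. ee (of_int (int r * (f x - f y)) / of_nat q))"
    by (subst sum.swap, rule sum.cong[OF refl], subst sum.swap) simp
  also have "\<dots> = (\<Sum>x\<in>X. \<Sum>y\<in>X. if int q dvd f x - f y then of_nat q else 0)"
    by (simp only: sum_ee_residues[OF assms(1)])
  also have "\<dots> = (\<Sum>z\<in>X \<times> X. if int q dvd f (fst z) - f (snd z) then of_nat q else 0)"
    by (simp add: sum.cartesian_product case_prod_beta)
  also have "\<dots> = complex_of_real (real q * real (card {(x, y) \<in> X \<times> X. int q dvd f x - f y}))"
  proof -
    have "{(x, y) \<in> X \<times> X. int q dvd f x - f y} = {z \<in> X \<times> X. int q dvd f (fst z) - f (snd z)}"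
      by auto
    then show ?thesis
      using assms(2) by (subst sum.inter_filter[symmetric]) simp_all
  qed
  finally show ?thesis
    by (simp only: of_real_eq_iff)
qed

lemma sin_pi_ge:
  assumes "0 \<le> x" "x \<le> 1 / 2"
  shows "2 * x \<le> sin (pi * x)"
proof -
  have "concave_on {0..pi} sin"
    by (rule f''_le0_imp_concave[where f' = cos and f'' = "\<lambda>x. - sin x"])
      (auto intro!: derivative_eq_intros sin_ge_zero)
  then have "(1 - 2 * x) * sin 0 + 2 * x * sin (pi / 2) \<le> sin ((1 - 2 * x) *\<^sub>R 0 + (2 * x) *\<^sub>R (pi / 2))"
    using assms by (intro concave_onD) auto
  then show ?thesis by (simp add: mult.commute)
qed

lemma sin_pi_frac_bound:
  assumes "0 < x" "x < 1"
  shows "sin (pi * x) > 0" "1 / sin (pi * x) \<le> 1 / (2 * x) + 1 / (2 * (1 - x))"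
proof -
  have refl: "sin (pi * (1 - x)) = sin (pi * x)"
    by (simp add: right_diff_distrib)
  consider "x \<le> 1 / 2" "2 * x \<le> sin (pi * x)" | "2 * (1 - x) \<le> sin (pi * x)"
    using sin_pi_ge[of x] sin_pi_ge[of "1 - x"] assms refl by (cases "x \<le> 1 / 2") auto
  then show "sin (pi * x) > 0" "1 / sin (pi * x) \<le> 1 / (2 * x) + 1 / (2 * (1 - x))"
  proof (atomize (full), cases)
    case 1
    then have "1 / sin (pi * x) \<le> 1 / (2 * x)"
      using assms by (intro divide_left_mono) auto
    then show "0 < sin (pi * x) \<and> 1 / sin (pi * x) \<le> 1 / (2 * x) + 1 / (2 * (1 - x))"
      using assms 1 by (auto intro: add_increasing2)
  next
    case 2
    then have "1 / sin (pi * x) \<le> 1 / (2 * (1 - x))"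
      using assms by (intro divide_left_mono) auto
    then show "0 < sin (pi * x) \<and> 1 / sin (pi * x) \<le> 1 / (2 * x) + 1 / (2 * (1 - x))"
      using assms 2 by (auto intro: add_increasing)
  qed
qed

lemma norm_ee_minus_1: "norm (ee x - 1) = 2 * \<bar>sin (pi * x)\<bar>"
proof -
  have "(norm (ee x - 1))\<^sup>2 = (cos (2 * pi * x) - 1)\<^sup>2 + (sin (2 * pi * x))\<^sup>2"
    by (simp add: ee_def cmod_power2)
  also have "\<dots> = 2 - 2 * cos (2 * (pi * x))"
    using sin_cos_squared_add[of "2 * pi * x"] by (simp add: power2_eq_square algebra_simps)
  also have "\<dots> = (2 * \<bar>sin (pi * x)\<bar>)\<^sup>2"
    by (simp only: cos_double_sin) (simp add: power_mult_distrib)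
  finally show ?thesis by (rule power2_eq_imp_eq) simp_all
qed

definition dirichlet_kernel :: "int \<Rightarrow> real \<Rightarrow> complex" where
  "dirichlet_kernel M x = (\<Sum>n\<in>{-M..M}. ee (of_int n * x))"

lemma norm_dirichlet_kernel_le:
  assumes "M \<ge> 0"
  shows "norm (dirichlet_kernel M x) \<le> 2 * of_int M + 1"
proof -
  have "norm (dirichlet_kernel M x) \<le> (\<Sum>n\<in>{-M..M}. 1)"
    unfolding dirichlet_kernel_def by (rule sum_norm_le) simp
  then show ?thesis using assms by simp
qed

lemma dirichlet_kernel_minus: "norm (dirichlet_kernel M (- x)) = norm (dirichlet_kernel M x)"
proof -
  have "dirichlet_kernel M (- x) = cnj (dirichlet_kernel M x)"
    by (simp add: dirichlet_kernel_def cnj_ee)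
  then show ?thesis by simp
qed

lemma dirichlet_kernel_frac: "dirichlet_kernel M (frac x) = dirichlet_kernel M x"
  unfolding dirichlet_kernel_def
proof (rule sum.cong[OF refl])
  fix n
  have "of_int n * x = of_int n * frac x + of_int (n * \<lfloor>x\<rfloor>)"
    by (simp add: frac_def algebra_simps)
  then show "ee (of_int n * frac x) = ee (of_int n * x)"
    by (simp only: ee_add_int)
qed

lemma norm_dirichlet_kernel_frac_le:
  assumes "M \<ge> 0" "frac x \<noteq> 0"
  shows "norm (dirichlet_kernel M x) \<le> 1 / (2 * frac x) + 1 / (2 * frac (- x))"
proof -
  define y where "y = frac x"
  have y: "0 < y" "y < 1" "frac (- x) = 1 - y"
    using assms(2) by (auto simp: y_def frac_lt_1 frac_neg frac_eq_0_iff frac_gt_0_iff)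
  have telescope: "dirichlet_kernel M y * (ee y - 1) = ee (of_int (M + 1) * y) - ee (of_int (- M) * y)"
  proof -
    have "dirichlet_kernel M y * (ee y - 1) =
        (\<Sum>n\<in>{-M..M}. ee (of_int (n + 1) * y) - ee (of_int n * y))"
    proof -
      have "ee (of_int n * y) * (ee y - 1) = ee (of_int (n + 1) * y) - ee (of_int n * y)" for n
        by (simp add: distrib_right ee_add right_diff_distrib)
      then show ?thesis
        by (simp only: dirichlet_kernel_def sum_distrib_right)
    qed
    also have "{-M..M} = (\<lambda>j. int j - M) ` {..<nat (2 * M + 1)}"
    proof -
      have "n \<in> (\<lambda>j. int j - M) ` {..<nat (2 * M + 1)}" if "n \<in> {-M..M}" for n
        using that assms(1) by (intro image_eqI[of _ _ "nat (n + M)"]) auto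
      then show ?thesis using assms(1) by auto
    qed
    also have "(\<Sum>n\<in>(\<lambda>j. int j - M) ` {..<nat (2 * M + 1)}. ee (of_int (n + 1) * y) - ee (of_int n * y))
       = (\<Sum>j<nat (2 * M + 1). ee (of_int (int (Suc j) - M) * y) - ee (of_int (int j - M) * y))"
      by (subst sum.reindex) (auto simp: inj_on_def algebra_simps)
    also have "\<dots> = ee (of_int (M + 1) * y) - ee (of_int (- M) * y)"
      using assms(1) by (subst sum_lessThan_telescope) simp
    finally show ?thesis .
  qed
  have "norm (dirichlet_kernel M y) * (2 * sin (pi * y)) = norm (dirichlet_kernel M y * (ee y - 1))"
    using sin_pi_frac_bound(1)[OF y(1,2)] by (simp add: norm_mult norm_ee_minus_1)
  also have "\<dots> \<le> 2"
    unfolding telescope using norm_triangle_ineq4[of "ee (of_int (M + 1) * y)" "ee (of_int (- M) * y)"]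
    by simp
  finally have "norm (dirichlet_kernel M y) \<le> 1 / sin (pi * y)"
    using sin_pi_frac_bound(1)[OF y(1,2)] by (simp add: field_simps)
  also have "\<dots> \<le> 1 / (2 * y) + 1 / (2 * (1 - y))"
    by (rule sin_pi_frac_bound(2)[OF y(1,2)])
  finally show ?thesis
    using y(3) by (simp add: y_def dirichlet_kernel_frac)
qed

lemma sum_inverse_frac_le:
  fixes x :: "'a \<Rightarrow> real"
  assumes "finite T" "\<delta> > 0"
    and away: "\<And>t m. t \<in> T \<Longrightarrow> \<delta> \<le> \<bar>x t - of_int m\<bar>"
    and sep: "\<And>s t m. s \<in> T \<Longrightarrow> t \<in> T \<Longrightarrow> s \<noteq> t \<Longrightarrow> \<delta> \<le> \<bar>x s - x t - of_int m\<bar>"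
  shows "(\<Sum>t\<in>T. 1 / frac (x t)) \<le> harm (nat \<lfloor>1 / \<delta>\<rfloor>) / \<delta>"
proof -
  define j where "j t = nat \<lfloor>frac (x t) / \<delta>\<rfloor>" for t
  have fr: "\<delta> \<le> frac (x t)" if "t \<in> T" for t
    using away[OF that, of "\<lfloor>x t\<rfloor>"] by (simp add: frac_def abs_of_nonneg)
  have j_real: "real (j t) = of_int \<lfloor>frac (x t) / \<delta>\<rfloor>" if "t \<in> T" for t
    using \<open>\<delta> > 0\<close> by (simp add: j_def)
  have j_low: "real (j t) * \<delta> \<le> frac (x t)" and j_up: "frac (x t) < (real (j t) + 1) * \<delta>"
    if "t \<in> T" for t
  proof -
    have "real (j t) \<le> frac (x t) / \<delta>" "frac (x t) / \<delta> < real (j t) + 1"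
      using j_real[OF that] by linarith+
    then show "real (j t) * \<delta> \<le> frac (x t)" "frac (x t) < (real (j t) + 1) * \<delta>"
      using \<open>\<delta> > 0\<close> by (simp_all add: field_simps)
  qed
  have j_range: "j t \<in> {1..nat \<lfloor>1 / \<delta>\<rfloor>}" if "t \<in> T" for t
  proof -
    have "1 \<le> frac (x t) / \<delta>"
      using fr[OF that] \<open>\<delta> > 0\<close> by simp
    moreover have "frac (x t) / \<delta> \<le> 1 / \<delta>"
      using frac_lt_1[of "x t"] \<open>\<delta> > 0\<close> by (intro divide_right_mono) auto
    ultimately show ?thesis
      unfolding j_def by (auto intro!: nat_mono floor_mono simp: le_nat_iff le_floor_iff)
  qed
  have inj: "inj_on j T"
  proof (rule inj_onI, rule ccontr)
    fix s t assume st: "s \<in> T" "t \<in> T" "j s = j t" "s \<noteq> t"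
    have "\<bar>frac (x s) - frac (x t)\<bar> < \<delta>"
      using j_low[OF st(1)] j_up[OF st(1)] j_low[OF st(2)] j_up[OF st(2)] st(3)
      by (auto simp: algebra_simps)
    moreover have "x s - x t - of_int (\<lfloor>x s\<rfloor> - \<lfloor>x t\<rfloor>) = frac (x s) - frac (x t)"
      by (simp add: frac_def)
    ultimately show False
      using sep[OF st(1,2,4), of "\<lfloor>x s\<rfloor> - \<lfloor>x t\<rfloor>"] by simp
  qed
  have "(\<Sum>t\<in>T. 1 / frac (x t)) \<le> (\<Sum>t\<in>T. 1 / (real (j t) * \<delta>))"
  proof (rule sum_mono)
    fix t assume t: "t \<in> T"
    then have "0 < real (j t) * \<delta>"
      using j_range[OF t] \<open>\<delta> > 0\<close> by auto
    then show "1 / frac (x t) \<le> 1 / (real (j t) * \<delta>)"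
      by (rule frac_le[OF zero_le_one order.refl _ j_low[OF t]])
  qed
  also have "\<dots> = (\<Sum>i\<in>j ` T. 1 / (real i * \<delta>))"
    by (simp add: sum.reindex[OF inj])
  also have "\<dots> \<le> (\<Sum>i\<in>{1..nat \<lfloor>1 / \<delta>\<rfloor>}. 1 / (real i * \<delta>))"
    using j_range \<open>\<delta> > 0\<close> by (intro sum_mono2) auto
  also have "\<dots> = harm (nat \<lfloor>1 / \<delta>\<rfloor>) / \<delta>"
    unfolding harm_def sum_divide_distrib by (intro sum.cong) (simp_all add: divide_simps)
  finally show ?thesis .
qed

lemma large_sieve_weak:
  fixes \<theta> :: "'a \<Rightarrow> real" and a :: "'a \<Rightarrow> complex"
  assumes "finite S" "\<delta> > 0" "M \<ge> 0"
    and sep: "\<And>s t m. s \<in> S \<Longrightarrow> t \<in> S \<Longrightarrow> s \<noteq> t \<Longrightarrow> \<delta> \<le> \<bar>\<theta> s - \<theta> t - of_int m\<bar>"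
  shows "(\<Sum>n\<in>{-M..M}. (norm (\<Sum>s\<in>S. a s * ee (of_int n * \<theta> s)))\<^sup>2)
    \<le> (2 * of_int M + 1 + harm (nat \<lfloor>1 / \<delta>\<rfloor>) / \<delta>) * (\<Sum>s\<in>S. (norm (a s))\<^sup>2)"
proof -
  define K where "K s t = norm (dirichlet_kernel M (\<theta> s - \<theta> t))" for s t
  define R where "R = 2 * of_int M + 1 + harm (nat \<lfloor>1 / \<delta>\<rfloor>) / \<delta>"
  have K_sym: "K s t = K t s" for s t
    using dirichlet_kernel_minus[of M "\<theta> t - \<theta> s"] by (simp add: K_def)
  have row: "(\<Sum>t\<in>S. K s t) \<le> R" if s: "s \<in> S" for s
  proof -
    have sep': "\<delta> \<le> \<bar>\<theta> t - \<theta> u - of_int m\<bar>" "\<delta> \<le> \<bar>\<theta> u - \<theta> t - of_int m\<bar>"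
      if "t \<in> S" "u \<in> S" "t \<noteq> u" for t u m
      using sep[of t u] sep[of u t] that by auto
    have frac0: "frac (\<theta> s - \<theta> t) \<noteq> 0" if t: "t \<in> S - {s}" for t
    proof
      assume "frac (\<theta> s - \<theta> t) = 0"
      then have "\<theta> s - \<theta> t = of_int \<lfloor>\<theta> s - \<theta> t\<rfloor>" by (simp add: frac_def)
      moreover have "\<delta> \<le> \<bar>\<theta> s - \<theta> t - of_int \<lfloor>\<theta> s - \<theta> t\<rfloor>\<bar>"
        using t by (intro sep[OF s]) auto
      ultimately show False
        using \<open>\<delta> > 0\<close> by linarith
    qed
    have "(\<Sum>t\<in>S - {s}. K s t) \<le> (\<Sum>t\<in>S - {s}. (1 / frac (\<theta> s - \<theta> t)) / 2 + (1 / frac (\<theta> t - \<theta> s)) / 2)"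
    proof (rule sum_mono)
      fix t assume t: "t \<in> S - {s}"
      then show "K s t \<le> (1 / frac (\<theta> s - \<theta> t)) / 2 + (1 / frac (\<theta> t - \<theta> s)) / 2"
        using norm_dirichlet_kernel_frac_le[OF \<open>M \<ge> 0\<close> frac0[OF t]] by (simp add: K_def mult.commute)
    qed
    also have "\<dots> = (\<Sum>t\<in>S - {s}. 1 / frac (\<theta> s - \<theta> t)) / 2 + (\<Sum>t\<in>S - {s}. 1 / frac (\<theta> t - \<theta> s)) / 2"
      by (simp add: sum.distrib sum_divide_distrib)
    also have "\<dots> \<le> (harm (nat \<lfloor>1 / \<delta>\<rfloor>) / \<delta>) / 2 + (harm (nat \<lfloor>1 / \<delta>\<rfloor>) / \<delta>) / 2"
    proof (intro add_mono divide_right_mono)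
      show "(\<Sum>t\<in>S - {s}. 1 / frac (\<theta> s - \<theta> t)) \<le> harm (nat \<lfloor>1 / \<delta>\<rfloor>) / \<delta>"
        using \<open>finite S\<close> \<open>\<delta> > 0\<close> s sep' by (intro sum_inverse_frac_le) auto
      show "(\<Sum>t\<in>S - {s}. 1 / frac (\<theta> t - \<theta> s)) \<le> harm (nat \<lfloor>1 / \<delta>\<rfloor>) / \<delta>"
        using \<open>finite S\<close> \<open>\<delta> > 0\<close> s sep' by (intro sum_inverse_frac_le) auto
    qed auto
    finally have "(\<Sum>t\<in>S - {s}. K s t) \<le> harm (nat \<lfloor>1 / \<delta>\<rfloor>) / \<delta>" by simp
    moreover have "K s s \<le> 2 * of_int M + 1"
      unfolding K_def by (rule norm_dirichlet_kernel_le[OF \<open>M \<ge> 0\<close>])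
    ultimately show ?thesis
      using \<open>finite S\<close> s by (simp add: R_def sum.remove[of S s])
  qed
  have "complex_of_real (\<Sum>n\<in>{-M..M}. (norm (\<Sum>s\<in>S. a s * ee (of_int n * \<theta> s)))\<^sup>2)
      = (\<Sum>n\<in>{-M..M}. \<Sum>s\<in>S. \<Sum>t\<in>S. a s * cnj (a t) * ee (of_int n * (\<theta> s - \<theta> t)))"
    unfolding of_real_sum norm_sum_square
    by (simp add: cnj_ee ee_add[symmetric] algebra_simps)
  also have "\<dots> = (\<Sum>s\<in>S. \<Sum>t\<in>S. a s * cnj (a t) * dirichlet_kernel M (\<theta> s - \<theta> t))"
    unfolding dirichlet_kernel_def sum_distrib_left
    by (subst sum.swap, rule sum.cong[OF refl], rule sum.swap)
  finally have eq: "complex_of_real (\<Sum>n\<in>{-M..M}. (norm (\<Sum>s\<in>S. a s * ee (of_int n * \<theta> s)))\<^sup>2)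
      = (\<Sum>s\<in>S. \<Sum>t\<in>S. a s * cnj (a t) * dirichlet_kernel M (\<theta> s - \<theta> t))" .
  have "(\<Sum>n\<in>{-M..M}. (norm (\<Sum>s\<in>S. a s * ee (of_int n * \<theta> s)))\<^sup>2)
      = norm (\<Sum>s\<in>S. \<Sum>t\<in>S. a s * cnj (a t) * dirichlet_kernel M (\<theta> s - \<theta> t))"
    unfolding eq[symmetric] norm_of_real by (simp add: sum_nonneg)
  also have "\<dots> \<le> (\<Sum>s\<in>S. \<Sum>t\<in>S. norm (a s) * norm (a t) * K s t)"
    by (intro sum_norm_le) (simp add: K_def norm_mult)
  also have "\<dots> \<le> (\<Sum>s\<in>S. \<Sum>t\<in>S. ((norm (a s))\<^sup>2 * K s t + (norm (a t))\<^sup>2 * K t s) / 2)"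
  proof (intro sum_mono)
    fix s t
    have "norm (a s) * norm (a t) \<le> ((norm (a s))\<^sup>2 + (norm (a t))\<^sup>2) / 2"
      using sum_squares_bound[of "norm (a s)" "norm (a t)"] by simp
    then have "norm (a s) * norm (a t) * K s t \<le> ((norm (a s))\<^sup>2 + (norm (a t))\<^sup>2) / 2 * K s t"
      by (intro mult_right_mono) (simp_all add: K_def)
    then show "norm (a s) * norm (a t) * K s t \<le> ((norm (a s))\<^sup>2 * K s t + (norm (a t))\<^sup>2 * K t s) / 2"
      using K_sym[of s t] by (simp add: algebra_simps add_divide_distrib)
  qed
  also have "\<dots> = (\<Sum>s\<in>S. \<Sum>t\<in>S. (norm (a s))\<^sup>2 * K s t)"
  proof -
    have "(\<Sum>s\<in>S. \<Sum>t\<in>S. (norm (a t))\<^sup>2 * K t s) = (\<Sum>s\<in>S. \<Sum>t\<in>S. (norm (a s))\<^sup>2 * K s t)"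
      by (rule sum.swap)
    then show ?thesis
      by (simp only: sum_divide_distrib[symmetric] sum.distrib) simp
  qed
  also have "\<dots> \<le> (\<Sum>s\<in>S. (norm (a s))\<^sup>2 * R)"
    unfolding sum_distrib_left[symmetric] using row by (intro sum_mono mult_left_mono) auto
  finally show ?thesis
    by (simp add: R_def sum_distrib_right[symmetric] mult.commute)
qed

section \<open>Averages over the congruence quotients\<close>

lemma mat_cong_iff_reduce: "mat_cong q M M' \<longleftrightarrow> reduce q M = reduce q M'"
  by (simp add: mat_cong_def reduce_def cong_def vec_eq_iff)

lemma reduce_reduce [simp]: "reduce q (reduce q M) = reduce q M"
  by (simp add: reduce_def vec_eq_iff)

lemma mat_cong_reduce: "mat_cong q (reduce q M) M"
  by (simp add: mat_cong_iff_reduce)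

lemma mat_cong_refl [simp]: "mat_cong q M M"
  by (simp add: mat_cong_def)

lemma mat_cong_sym: "mat_cong q M M' \<Longrightarrow> mat_cong q M' M"
  by (simp add: mat_cong_iff_reduce)

lemma mat_cong_trans: "mat_cong q M M' \<Longrightarrow> mat_cong q M' M'' \<Longrightarrow> mat_cong q M M''"
  by (simp add: mat_cong_iff_reduce)

lemma mat_cong_mult:
  assumes "mat_cong q M M'" "mat_cong q N N'"
  shows "mat_cong q (M ** N) (M' ** N')"
  using assms unfolding mat_cong_def matrix_matrix_mult_def
  by (auto intro!: cong_sum cong_mult)

lemma mat_cong_dvd: "mat_cong q M M' \<Longrightarrow> d dvd q \<Longrightarrow> mat_cong d M M'"
  unfolding mat_cong_def using cong_dvd_modulus by (metis int_dvd_int_iff)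

lemma mat_cong_lin_form:
  assumes "mat_cong q M M'"
  shows "[lin_form A B C D M = lin_form A B C D M'] (mod int q)"
  using assms unfolding mat_cong_def lin_form_def
  by (intro cong_add cong_mult cong_refl) auto

lemma finite_image_reduce:
  assumes "q > 0"
  shows "finite (reduce q ` \<Gamma>)"
proof -
  let ?f = "\<lambda>M :: mat2. (M $ 1 $ 1, M $ 1 $ 2, M $ 2 $ 1, M $ 2 $ 2)"
  have "?f ` reduce q ` \<Gamma> \<subseteq> {0..<int q} \<times> {0..<int q} \<times> {0..<int q} \<times> {0..<int q}"
    using assms by (auto simp: reduce_def)
  then have "finite (?f ` reduce q ` \<Gamma>)"
    by (rule finite_subset) simp
  moreover have "inj_on ?f (reduce q ` \<Gamma>)"
    by (auto simp: inj_on_def vec_eq_iff forall_2)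
  ultimately show ?thesis by (rule finite_imageD)
qed

context
  fixes \<Gamma> :: "mat2 set"
  assumes subgrp: "subgroup \<Gamma> SL2Z"
begin

lemma one_mem: "mat 1 \<in> \<Gamma>"
  using subgroup.one_closed[OF subgrp] by (simp add: SL2Z_def)

lemma mult_mem: "g \<in> \<Gamma> \<Longrightarrow> h \<in> \<Gamma> \<Longrightarrow> g ** h \<in> \<Gamma>"
  using subgroup.m_closed[OF subgrp] by (simp add: SL2Z_def)

lemma inverse_mem:
  assumes "g \<in> \<Gamma>"
  obtains h where "h \<in> \<Gamma>" "h ** g = mat 1" "g ** h = mat 1"
proof -
  interpret group SL2Z by (rule group_SL2Z)
  have g: "g \<in> carrier SL2Z" using subgroup.subset[OF subgrp] assms by auto
  show ?thesis
    using that[OF subgroup.m_inv_closed[OF subgrp assms]] l_inv[OF g] r_inv[OF g]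
    by (simp add: SL2Z_def)
qed

lemma r_coset_cong_sub:
  assumes "g \<in> \<Gamma>"
  shows "cong_sub \<Gamma> q #>\<^bsub>grp \<Gamma>\<^esub> g = {\<gamma> \<in> \<Gamma>. reduce q \<gamma> = reduce q g}"
proof (intro Set.set_eqI iffI)
  fix x assume "x \<in> cong_sub \<Gamma> q #>\<^bsub>grp \<Gamma>\<^esub> g"
  then obtain h where h: "h \<in> \<Gamma>" "mat_cong q h (mat 1)" "x = h ** g"
    by (auto simp: r_coset_def SL2Z_def cong_sub_def)
  then have "mat_cong q x (mat 1 ** g)"
    by (simp only: mat_cong_mult mat_cong_refl)
  then show "x \<in> {\<gamma> \<in> \<Gamma>. reduce q \<gamma> = reduce q g}"
    using h mult_mem assms by (simp add: mat_cong_iff_reduce)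
next
  fix x assume x: "x \<in> {\<gamma> \<in> \<Gamma>. reduce q \<gamma> = reduce q g}"
  obtain h where h: "h \<in> \<Gamma>" "h ** g = mat 1" "g ** h = mat 1"
    using inverse_mem[OF assms] .
  have "mat_cong q (x ** h) (g ** h)"
    using x by (intro mat_cong_mult) (auto simp: mat_cong_iff_reduce)
  then have "x ** h \<in> cong_sub \<Gamma> q"
    using x h mult_mem by (simp add: cong_sub_def)
  moreover have "x = (x ** h) ** g"
    by (simp add: matrix_mul_assoc[symmetric] h)
  ultimately show "x \<in> cong_sub \<Gamma> q #>\<^bsub>grp \<Gamma>\<^esub> g"
    unfolding r_coset_def by (auto simp: SL2Z_def)
qed

lemma rcosets_cong_sub:
  "rcosets\<^bsub>grp \<Gamma>\<^esub> cong_sub \<Gamma> q = (\<lambda>g. {\<gamma> \<in> \<Gamma>. reduce q \<gamma> = reduce q g}) ` \<Gamma>"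
  using r_coset_cong_sub by (auto simp: RCOSETS_def)

lemma bij_betw_rcosets_image_reduce:
  "bij_betw (\<lambda>K. reduce q (SOME \<gamma>. \<gamma> \<in> K)) (rcosets\<^bsub>grp \<Gamma>\<^esub> cong_sub \<Gamma> q) (reduce q ` \<Gamma>)"
proof -
  have some: "reduce q (SOME \<gamma>. \<gamma> \<in> {\<gamma> \<in> \<Gamma>. reduce q \<gamma> = reduce q g}) = reduce q g" if "g \<in> \<Gamma>" for g
    using someI_ex[of "\<lambda>\<gamma>. \<gamma> \<in> {\<gamma> \<in> \<Gamma>. reduce q \<gamma> = reduce q g}"] that by blast
  show ?thesis
    unfolding bij_betw_def rcosets_cong_sub
  proof
    show "inj_on (\<lambda>K. reduce q (SOME \<gamma>. \<gamma> \<in> K)) ((\<lambda>g. {\<gamma> \<in> \<Gamma>. reduce q \<gamma> = reduce q g}) ` \<Gamma>)"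
    proof (rule inj_onI, clarify)
      fix g h assume "g \<in> \<Gamma>" "h \<in> \<Gamma>"
        "reduce q (SOME \<gamma>. \<gamma> \<in> {\<gamma> \<in> \<Gamma>. reduce q \<gamma> = reduce q g})
         = reduce q (SOME \<gamma>. \<gamma> \<in> {\<gamma> \<in> \<Gamma>. reduce q \<gamma> = reduce q h})"
      then show "{\<gamma> \<in> \<Gamma>. reduce q \<gamma> = reduce q g} = {\<gamma> \<in> \<Gamma>. reduce q \<gamma> = reduce q h}"
        by (simp only: some)
    qed
    show "(\<lambda>K. reduce q (SOME \<gamma>. \<gamma> \<in> K)) ` (\<lambda>g. {\<gamma> \<in> \<Gamma>. reduce q \<gamma> = reduce q g}) ` \<Gamma> = reduce q ` \<Gamma>"
      unfolding image_image by (rule image_cong[OF refl some])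
  qed
qed

lemma natural_map_surj_imp_crt:
  assumes "bij_betw (natural_map \<Gamma> q\<^sub>1 q\<^sub>2)
        (carrier (grp \<Gamma> Mod cong_sub \<Gamma> (q\<^sub>1 * q\<^sub>2)))
        (carrier (grp \<Gamma> Mod cong_sub \<Gamma> q\<^sub>1) \<times> carrier (grp \<Gamma> Mod cong_sub \<Gamma> q\<^sub>2))"
    and "g\<^sub>1 \<in> \<Gamma>" "g\<^sub>2 \<in> \<Gamma>"
  obtains g where "g \<in> \<Gamma>" "reduce q\<^sub>1 g = reduce q\<^sub>1 g\<^sub>1" "reduce q\<^sub>2 g = reduce q\<^sub>2 g\<^sub>2"
proof -
  define coset where "coset q g = {\<gamma> \<in> \<Gamma>. reduce q \<gamma> = reduce q g}" for q g
  have carrier: "carrier (grp \<Gamma> Mod cong_sub \<Gamma> q) = coset q ` \<Gamma>" for q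
    using rcosets_cong_sub by (simp add: FactGroup_def coset_def[abs_def])
  have "natural_map \<Gamma> q\<^sub>1 q\<^sub>2 ` coset (q\<^sub>1 * q\<^sub>2) ` \<Gamma> = coset q\<^sub>1 ` \<Gamma> \<times> coset q\<^sub>2 ` \<Gamma>"
    using assms(1) unfolding carrier by (rule bij_betw_imp_surj_on)
  then have "(coset q\<^sub>1 g\<^sub>1, coset q\<^sub>2 g\<^sub>2) \<in> natural_map \<Gamma> q\<^sub>1 q\<^sub>2 ` coset (q\<^sub>1 * q\<^sub>2) ` \<Gamma>"
    using assms by simp
  then obtain g where g: "g \<in> \<Gamma>"
    "cong_sub \<Gamma> q\<^sub>1 <#>\<^bsub>grp \<Gamma>\<^esub> coset (q\<^sub>1 * q\<^sub>2) g = coset q\<^sub>1 g\<^sub>1"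
    "cong_sub \<Gamma> q\<^sub>2 <#>\<^bsub>grp \<Gamma>\<^esub> coset (q\<^sub>1 * q\<^sub>2) g = coset q\<^sub>2 g\<^sub>2"
    by (auto simp: natural_map_def)
  have "g \<in> cong_sub \<Gamma> q <#>\<^bsub>grp \<Gamma>\<^esub> coset (q\<^sub>1 * q\<^sub>2) g" for q
  proof -
    have "mat 1 \<in> cong_sub \<Gamma> q" "g \<in> coset (q\<^sub>1 * q\<^sub>2) g"
      using one_mem g(1) by (auto simp: cong_sub_def coset_def)
    then show ?thesis
      unfolding set_mult_def by (auto simp: SL2Z_def intro!: bexI[of _ "mat 1" "cong_sub \<Gamma> q"])
  qed
  then have "g \<in> coset q\<^sub>1 g\<^sub>1" "g \<in> coset q\<^sub>2 g\<^sub>2"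
    unfolding g(2,3)[symmetric] by blast+
  then show ?thesis using that[of g] by (simp add: coset_def)
qed

lemma sum_image_reduce_translate:
  assumes "g \<in> \<Gamma>" and cong: "\<And>M M'. mat_cong q M M' \<Longrightarrow> \<phi> M = \<phi> M'"
  shows "(\<Sum>M\<in>reduce q ` \<Gamma>. \<phi> (g ** M)) = (\<Sum>M\<in>reduce q ` \<Gamma>. \<phi> M)"
proof -
  obtain h where h: "h \<in> \<Gamma>" "h ** g = mat 1" "g ** h = mat 1"
    using inverse_mem[OF assms(1)] .
  have mem: "reduce q (f ** M) \<in> reduce q ` \<Gamma>" if "f \<in> \<Gamma>" "M \<in> reduce q ` \<Gamma>" for f M
  proof -
    obtain N where N: "N \<in> \<Gamma>" "M = reduce q N" using \<open>M \<in> _\<close> by auto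
    have "mat_cong q (f ** M) (f ** N)"
      unfolding N by (intro mat_cong_mult mat_cong_refl mat_cong_reduce)
    then show ?thesis using mult_mem[OF \<open>f \<in> \<Gamma>\<close> N(1)] by (simp add: mat_cong_iff_reduce)
  qed
  have inv: "reduce q (f ** reduce q (f' ** M)) = M"
    if "f ** f' = mat 1" "M \<in> reduce q ` \<Gamma>" for f f' M
  proof -
    have "mat_cong q (f ** reduce q (f' ** M)) (f ** (f' ** M))"
      by (intro mat_cong_mult mat_cong_refl mat_cong_reduce)
    then show ?thesis
      using that by (auto simp: mat_cong_iff_reduce matrix_mul_assoc)
  qed
  show ?thesis
  proof (rule sum.reindex_bij_witness[of _ "\<lambda>M. reduce q (h ** M)" "\<lambda>M. reduce q (g ** M)"])
    fix M assume "M \<in> reduce q ` \<Gamma>"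
    then show "\<phi> (reduce q (g ** M)) = \<phi> (g ** M)"
      by (intro cong mat_cong_reduce)
  qed (use h assms(1) mem inv in auto)
qed

end

definition weyl_sum :: "mat2 set \<Rightarrow> (mat2 \<Rightarrow> int) \<Rightarrow> nat \<Rightarrow> int \<Rightarrow> complex" where
  "weyl_sum X L q r = (\<Sum>M\<in>X. ee (of_int (r * L M) / of_nat q))"

definition weyl_avg :: "mat2 set \<Rightarrow> (mat2 \<Rightarrow> int) \<Rightarrow> nat \<Rightarrow> int \<Rightarrow> complex" where
  "weyl_avg \<Gamma> L q r = weyl_sum (reduce q ` \<Gamma>) L q r / of_nat (card (reduce q ` \<Gamma>))"

definition weyl_energy :: "mat2 set \<Rightarrow> (mat2 \<Rightarrow> int) \<Rightarrow> nat \<Rightarrow> real" where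
  "weyl_energy \<Gamma> L q = (\<Sum>r | r < q \<and> coprime r q. (norm (weyl_avg \<Gamma> L q (int r)))\<^sup>2)"

lemma ramanujan_sum_ee:
  "ramanujan_sum q x = (\<Sum>r | r < q \<and> coprime r q. ee (of_int (int r * x) / of_nat q))"
  by (simp add: ramanujan_sum_def ee_def cis_conv_exp mult_ac)

lemma sing_series_eq_sum_weyl_avg:
  assumes "subgroup \<Gamma> SL2Z" "q > 0"
  shows "sing_series \<Gamma> A B C D q n =
    (\<Sum>r | r < q \<and> coprime r q.
       weyl_avg \<Gamma> (lin_form A B C D) q (int r) * ee (of_int n * - (real r / real q)))"
proof -
  define L where "L = lin_form A B C D"
  define X where "X = reduce q ` \<Gamma>"
  have bij: "bij_betw (\<lambda>K. reduce q (SOME \<gamma>. \<gamma> \<in> K)) (rcosets\<^bsub>grp \<Gamma>\<^esub> cong_sub \<Gamma> q) X"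
    unfolding X_def by (rule bij_betw_rcosets_image_reduce[OF assms(1)])
  have "(\<Sum>K \<in> rcosets\<^bsub>grp \<Gamma>\<^esub> cong_sub \<Gamma> q. ramanujan_sum q (L (SOME \<gamma>. \<gamma> \<in> K) - n))
      = (\<Sum>K \<in> rcosets\<^bsub>grp \<Gamma>\<^esub> cong_sub \<Gamma> q. ramanujan_sum q (L (reduce q (SOME \<gamma>. \<gamma> \<in> K)) - n))"
    unfolding L_def using assms(2)
    by (intro sum.cong refl ramanujan_sum_cong cong_diff cong_refl mat_cong_lin_form mat_cong_sym[OF mat_cong_reduce])
  also have "\<dots> = (\<Sum>M\<in>X. ramanujan_sum q (L M - n))"
    using sum.reindex_bij_betw[OF bij, of "\<lambda>M. ramanujan_sum q (L M - n)"] by simp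
  also have "\<dots> = (\<Sum>r | r < q \<and> coprime r q. \<Sum>M\<in>X. ee (of_int (int r * (L M - n)) / of_nat q))"
    unfolding ramanujan_sum_ee by (rule sum.swap)
  also have "\<dots> = (\<Sum>r | r < q \<and> coprime r q. weyl_sum X L q (int r) * ee (of_int n * - (real r / real q)))"
    unfolding weyl_sum_def sum_distrib_right
    by (simp add: ee_add[symmetric] algebra_simps diff_divide_distrib)
  finally show ?thesis
    using bij_betw_same_card[OF bij]
    by (simp add: sing_series_def L_def weyl_avg_def X_def[symmetric] sum_divide_distrib)
qed

lemma ee_lin_form_cong:
  assumes "q > 0" "mat_cong q M M'" "[r = r'] (mod int q)"
  shows "ee (of_int (r * lin_form A B C D M) / of_nat q) = ee (of_int (r' * lin_form A B C D M') / of_nat q)"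
  using assms by (intro ee_cong cong_mult mat_cong_lin_form)

lemma weyl_avg_cong:
  assumes "q > 0" "[r = r'] (mod int q)"
  shows "weyl_avg \<Gamma> (lin_form A B C D) q r = weyl_avg \<Gamma> (lin_form A B C D) q r'"
  unfolding weyl_avg_def weyl_sum_def using ee_lin_form_cong[OF assms(1) mat_cong_refl assms(2)] by simp

lemma norm_weyl_avg_le_1: "norm (weyl_avg \<Gamma> L q r) \<le> 1"
proof -
  have "norm (weyl_sum (reduce q ` \<Gamma>) L q r) \<le> (\<Sum>M\<in>reduce q ` \<Gamma>. 1)"
    unfolding weyl_sum_def by (rule sum_norm_le) simp
  then show ?thesis
    by (simp add: weyl_avg_def norm_divide divide_le_eq_1) linarith
qed

lemma weyl_energy_nonneg: "weyl_energy \<Gamma> L q \<ge> 0"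
  by (simp add: weyl_energy_def sum_nonneg)

lemma weyl_energy_le: "weyl_energy \<Gamma> L q \<le> q"
proof -
  have "weyl_energy \<Gamma> L q \<le> (\<Sum>r | r < q \<and> coprime r q. 1)"
    unfolding weyl_energy_def
    by (intro sum_mono) (simp add: power_le_one norm_weyl_avg_le_1)
  also have "\<dots> \<le> real (card {..<q})"
    using card_mono[of "{..<q}" "{r. r < q \<and> coprime r q}"] by auto
  finally show ?thesis by simp
qed

lemma weyl_avg_coprime:
  assumes "subgroup \<Gamma> SL2Z" "q\<^sub>1 > 0" "q\<^sub>2 > 0" "coprime q\<^sub>1 q\<^sub>2"
    and crt: "bij_betw (natural_map \<Gamma> q\<^sub>1 q\<^sub>2)
        (carrier (grp \<Gamma> Mod cong_sub \<Gamma> (q\<^sub>1 * q\<^sub>2)))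
        (carrier (grp \<Gamma> Mod cong_sub \<Gamma> q\<^sub>1) \<times> carrier (grp \<Gamma> Mod cong_sub \<Gamma> q\<^sub>2))"
  shows "weyl_avg \<Gamma> (lin_form A B C D) (q\<^sub>1 * q\<^sub>2) (r\<^sub>1 * int q\<^sub>2 + r\<^sub>2 * int q\<^sub>1)
    = weyl_avg \<Gamma> (lin_form A B C D) q\<^sub>1 r\<^sub>1 * weyl_avg \<Gamma> (lin_form A B C D) q\<^sub>2 r\<^sub>2"
proof -
  define L where "L = lin_form A B C D"
  define X where "X q = reduce q ` \<Gamma>" for q
  have bij: "bij_betw (\<lambda>M. (reduce q\<^sub>1 M, reduce q\<^sub>2 M)) (X (q\<^sub>1 * q\<^sub>2)) (X q\<^sub>1 \<times> X q\<^sub>2)"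
    unfolding bij_betw_def
  proof
    have red: "reduce q\<^sub>1 (reduce (q\<^sub>1 * q\<^sub>2) M) = reduce q\<^sub>1 M" "reduce q\<^sub>2 (reduce (q\<^sub>1 * q\<^sub>2) M) = reduce q\<^sub>2 M" for M
      using mat_cong_dvd[OF mat_cong_reduce[of "q\<^sub>1 * q\<^sub>2" M]] by (auto simp: mat_cong_iff_reduce)
    show "inj_on (\<lambda>M. (reduce q\<^sub>1 M, reduce q\<^sub>2 M)) (X (q\<^sub>1 * q\<^sub>2))"
    proof (rule inj_onI, unfold X_def, clarify)
      fix M N assume "reduce q\<^sub>1 (reduce (q\<^sub>1 * q\<^sub>2) M) = reduce q\<^sub>1 (reduce (q\<^sub>1 * q\<^sub>2) N)"
        "reduce q\<^sub>2 (reduce (q\<^sub>1 * q\<^sub>2) M) = reduce q\<^sub>2 (reduce (q\<^sub>1 * q\<^sub>2) N)"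
      then have "mat_cong q\<^sub>1 M N" "mat_cong q\<^sub>2 M N"
        by (simp_all add: red mat_cong_iff_reduce)
      then have "mat_cong (q\<^sub>1 * q\<^sub>2) M N"
        using \<open>coprime q\<^sub>1 q\<^sub>2\<close> unfolding mat_cong_def of_nat_mult
        by (auto intro!: coprime_cong_mult)
      then show "reduce (q\<^sub>1 * q\<^sub>2) M = reduce (q\<^sub>1 * q\<^sub>2) N"
        by (simp add: mat_cong_iff_reduce)
    qed
    show "(\<lambda>M. (reduce q\<^sub>1 M, reduce q\<^sub>2 M)) ` X (q\<^sub>1 * q\<^sub>2) = X q\<^sub>1 \<times> X q\<^sub>2"
    proof (intro equalityI subsetI)
      fix z assume "z \<in> X q\<^sub>1 \<times> X q\<^sub>2"
      then obtain g\<^sub>1 g\<^sub>2 where g: "g\<^sub>1 \<in> \<Gamma>" "g\<^sub>2 \<in> \<Gamma>" "z = (reduce q\<^sub>1 g\<^sub>1, reduce q\<^sub>2 g\<^sub>2)"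
        by (auto simp: X_def)
      obtain g where "g \<in> \<Gamma>" "reduce q\<^sub>1 g = reduce q\<^sub>1 g\<^sub>1" "reduce q\<^sub>2 g = reduce q\<^sub>2 g\<^sub>2"
        using natural_map_surj_imp_crt[OF assms(1) crt g(1,2)] .
      then show "z \<in> (\<lambda>M. (reduce q\<^sub>1 M, reduce q\<^sub>2 M)) ` X (q\<^sub>1 * q\<^sub>2)"
        unfolding X_def image_image red g(3) by (intro image_eqI[of _ _ g]) auto
    qed (auto simp: X_def red)
  qed
  have "weyl_sum (X (q\<^sub>1 * q\<^sub>2)) L (q\<^sub>1 * q\<^sub>2) (r\<^sub>1 * int q\<^sub>2 + r\<^sub>2 * int q\<^sub>1)
      = (\<Sum>M\<in>X (q\<^sub>1 * q\<^sub>2). ee (of_int (r\<^sub>1 * L M) / of_nat q\<^sub>1) * ee (of_int (r\<^sub>2 * L M) / of_nat q\<^sub>2))"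
    unfolding weyl_sum_def ee_add[symmetric] using assms(2,3)
    by (intro sum.cong refl arg_cong[of _ _ ee]) (simp add: field_simps)
  also have "\<dots> = (\<Sum>M\<in>X (q\<^sub>1 * q\<^sub>2). (\<lambda>(M\<^sub>1, M\<^sub>2). ee (of_int (r\<^sub>1 * L M\<^sub>1) / of_nat q\<^sub>1)
      * ee (of_int (r\<^sub>2 * L M\<^sub>2) / of_nat q\<^sub>2)) (reduce q\<^sub>1 M, reduce q\<^sub>2 M))"
    unfolding L_def prod.case using assms(2,3)
    by (intro sum.cong refl arg_cong2[of _ _ _ _ "(*)"] ee_lin_form_cong cong_refl mat_cong_sym[OF mat_cong_reduce])
  also have "\<dots> = (\<Sum>(M\<^sub>1, M\<^sub>2)\<in>X q\<^sub>1 \<times> X q\<^sub>2. ee (of_int (r\<^sub>1 * L M\<^sub>1) / of_nat q\<^sub>1)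
      * ee (of_int (r\<^sub>2 * L M\<^sub>2) / of_nat q\<^sub>2))"
    by (rule sum.reindex_bij_betw[OF bij])
  also have "\<dots> = weyl_sum (X q\<^sub>1) L q\<^sub>1 r\<^sub>1 * weyl_sum (X q\<^sub>2) L q\<^sub>2 r\<^sub>2"
    by (simp add: weyl_sum_def sum_product sum.cartesian_product)
  finally show ?thesis
    using bij_betw_same_card[OF bij]
    by (simp add: weyl_avg_def L_def X_def[symmetric] card_cartesian_product)
qed

lemma weyl_energy_coprime_le:
  assumes "subgroup \<Gamma> SL2Z" "q\<^sub>1 > 0" "q\<^sub>2 > 0" "coprime q\<^sub>1 q\<^sub>2"
    and crt: "bij_betw (natural_map \<Gamma> q\<^sub>1 q\<^sub>2)
        (carrier (grp \<Gamma> Mod cong_sub \<Gamma> (q\<^sub>1 * q\<^sub>2)))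
        (carrier (grp \<Gamma> Mod cong_sub \<Gamma> q\<^sub>1) \<times> carrier (grp \<Gamma> Mod cong_sub \<Gamma> q\<^sub>2))"
  shows "weyl_energy \<Gamma> (lin_form A B C D) (q\<^sub>1 * q\<^sub>2)
    \<le> weyl_energy \<Gamma> (lin_form A B C D) q\<^sub>1 * weyl_energy \<Gamma> (lin_form A B C D) q\<^sub>2"
proof -
  define U where "U q = {r. r < q \<and> coprime r q}" for q :: nat
  define F where "F q r = (norm (weyl_avg \<Gamma> (lin_form A B C D) q (int r)))\<^sup>2" for q r
  obtain v\<^sub>1 v\<^sub>2 where v: "[v\<^sub>1 * q\<^sub>1 = 1] (mod q\<^sub>2)" "[v\<^sub>2 * q\<^sub>2 = 1] (mod q\<^sub>1)"
    using cong_solve_coprime_nat[of q\<^sub>1 q\<^sub>2] cong_solve_coprime_nat[of q\<^sub>2 q\<^sub>1] assms(4)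
    by (metis coprime_commute mult.commute One_nat_def)
  define f where "f r = ((r * v\<^sub>2) mod q\<^sub>1, (r * v\<^sub>1) mod q\<^sub>2)" for r
  have split\<^sub>1: "[fst (f r) * q\<^sub>2 = r] (mod q\<^sub>1)" for r
    using cong_mult[OF cong_refl v(2), of r] by (simp add: f_def cong_def mod_mult_left_eq mult.assoc)
  have split\<^sub>2: "[snd (f r) * q\<^sub>1 = r] (mod q\<^sub>2)" for r
    using cong_mult[OF cong_refl v(1), of r] by (simp add: f_def cong_def mod_mult_left_eq mult.assoc)
  have split: "[fst (f r) * q\<^sub>2 + snd (f r) * q\<^sub>1 = r] (mod q\<^sub>1 * q\<^sub>2)" for r
    using split\<^sub>1[of r] split\<^sub>2[of r] assms(4)
    by (intro coprime_cong_mult_nat) (auto simp: cong_def)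
  have inj: "inj_on f (U (q\<^sub>1 * q\<^sub>2))"
  proof (rule inj_onI)
    fix r s assume "r \<in> U (q\<^sub>1 * q\<^sub>2)" "s \<in> U (q\<^sub>1 * q\<^sub>2)" "f r = f s"
    then have "[r = s] (mod q\<^sub>1 * q\<^sub>2)" using split[of r] split[of s] by (metis cong_sym cong_trans)
    then show "r = s" using \<open>r \<in> _\<close> \<open>s \<in> _\<close> by (auto simp: U_def cong_def)
  qed
  have range: "f ` U (q\<^sub>1 * q\<^sub>2) \<subseteq> U q\<^sub>1 \<times> U q\<^sub>2"
  proof (rule image_subsetI)
    fix r assume r: "r \<in> U (q\<^sub>1 * q\<^sub>2)"
    then have "coprime (fst (f r) * q\<^sub>2) q\<^sub>1" "coprime (snd (f r) * q\<^sub>1) q\<^sub>2"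
      using cong_imp_coprime[OF cong_sym[OF split\<^sub>1[of r]]] cong_imp_coprime[OF cong_sym[OF split\<^sub>2[of r]]]
      by (auto simp: U_def)
    then show "f r \<in> U q\<^sub>1 \<times> U q\<^sub>2"
      using assms(2,3) by (simp add: U_def f_def)
  qed
  have "weyl_energy \<Gamma> (lin_form A B C D) (q\<^sub>1 * q\<^sub>2) = (\<Sum>r\<in>U (q\<^sub>1 * q\<^sub>2). F (q\<^sub>1 * q\<^sub>2) r)"
    by (simp add: weyl_energy_def U_def F_def)
  also have "\<dots> = (\<Sum>r\<in>U (q\<^sub>1 * q\<^sub>2). (\<lambda>(r\<^sub>1, r\<^sub>2). F q\<^sub>1 r\<^sub>1 * F q\<^sub>2 r\<^sub>2) (f r))"
  proof (rule sum.cong[OF refl])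
    fix r
    have "[int r = int (fst (f r)) * int q\<^sub>2 + int (snd (f r)) * int q\<^sub>1] (mod int (q\<^sub>1 * q\<^sub>2))"
      using cong_int_iff[THEN iffD2, OF cong_sym[OF split[of r]]] by simp
    then have "weyl_avg \<Gamma> (lin_form A B C D) (q\<^sub>1 * q\<^sub>2) (int r)
      = weyl_avg \<Gamma> (lin_form A B C D) (q\<^sub>1 * q\<^sub>2) (int (fst (f r)) * int q\<^sub>2 + int (snd (f r)) * int q\<^sub>1)"
      using assms(2,3) by (intro weyl_avg_cong) auto
    then show "F (q\<^sub>1 * q\<^sub>2) r = (\<lambda>(r\<^sub>1, r\<^sub>2). F q\<^sub>1 r\<^sub>1 * F q\<^sub>2 r\<^sub>2) (f r)"
      by (simp add: F_def weyl_avg_coprime[OF assms] norm_mult power_mult_distrib case_prod_beta)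
  qed
  also have "\<dots> = (\<Sum>z\<in>f ` U (q\<^sub>1 * q\<^sub>2). (\<lambda>(r\<^sub>1, r\<^sub>2). F q\<^sub>1 r\<^sub>1 * F q\<^sub>2 r\<^sub>2) z)"
    by (simp add: sum.reindex[OF inj])
  also have "\<dots> \<le> (\<Sum>z\<in>U q\<^sub>1 \<times> U q\<^sub>2. (\<lambda>(r\<^sub>1, r\<^sub>2). F q\<^sub>1 r\<^sub>1 * F q\<^sub>2 r\<^sub>2) z)"
    using range by (intro sum_mono2) (auto simp: U_def F_def)
  also have "\<dots> = weyl_energy \<Gamma> (lin_form A B C D) q\<^sub>1 * weyl_energy \<Gamma> (lin_form A B C D) q\<^sub>2"
    by (simp add: weyl_energy_def U_def F_def sum_product sum.cartesian_product)
  finally show ?thesis .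
qed

text \<open>On the part where the phase shift \<open>r s (A c + B d) / q\<close> is not an integer, the summand is a
  coboundary for translation by \<open>g\<close>, so its sum vanishes.\<close>

lemma weyl_sum_support:
  assumes "subgroup \<Gamma> SL2Z" "q > 0" "g \<in> \<Gamma>"
    and g: "mat_cong q g (vector [vector [1, s], vector [0, 1]])"
  shows "weyl_sum (reduce q ` \<Gamma>) (lin_form A B C D) q r
    = weyl_sum {M \<in> reduce q ` \<Gamma>. int q dvd r * s * (A * M $ 2 $ 1 + B * M $ 2 $ 2)} (lin_form A B C D) q r"
proof -
  define X where "X = reduce q ` \<Gamma>"
  define L where "L = lin_form A B C D"
  define w where "w M = r * s * (A * M $ 2 $ 1 + B * M $ 2 $ 2)" for M :: mat2
  define \<zeta> where "\<zeta> M = ee (of_int (w M) / of_nat q)" for M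
  define \<phi> where "\<phi> M = ee (of_int (r * L M) / of_nat q)" for M
  define \<psi> where "\<psi> M = (if \<zeta> M = 1 then 0 else \<phi> M / (\<zeta> M - 1))" for M
  have \<zeta>_cong: "\<zeta> M = \<zeta> M'" if "mat_cong q M M'" for M M'
    unfolding \<zeta>_def w_def using that assms(2) unfolding mat_cong_def
    by (intro ee_cong cong_mult cong_add cong_refl) auto
  have \<phi>_cong: "\<phi> M = \<phi> M'" if "mat_cong q M M'" for M M'
    unfolding \<phi>_def L_def by (rule ee_lin_form_cong[OF assms(2) that cong_refl])
  define u :: mat2 where "u = vector [vector [1, s], vector [0, 1]]"
  have gu: "mat_cong q (g ** M) (u ** M)" for M
    using g by (intro mat_cong_mult mat_cong_refl) (simp add: u_def)
  have "\<zeta> (g ** M) = \<zeta> M" for M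
  proof -
    have "w (u ** M) = w M"
      by (simp add: w_def u_def matrix_matrix_mult_def sum_2)
    then show ?thesis using \<zeta>_cong[OF gu, of M] by (simp add: \<zeta>_def)
  qed
  moreover have "\<phi> (g ** M) = \<zeta> M * \<phi> M" for M
  proof -
    have "r * L (u ** M) = w M + r * L M"
      by (simp add: w_def L_def lin_form_def u_def matrix_matrix_mult_def sum_2 algebra_simps)
    then have "\<phi> (u ** M) = \<zeta> M * \<phi> M"
      by (simp only: \<phi>_def \<zeta>_def ee_add[symmetric] of_int_add add_divide_distrib)
    then show ?thesis using \<phi>_cong[OF gu, of M] by simp
  qed
  ultimately have cobound: "\<psi> (g ** M) - \<psi> M = (if \<zeta> M = 1 then 0 else \<phi> M)" for M
    by (simp add: \<psi>_def diff_divide_distrib[symmetric]) (simp add: field_simps)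
  have "(\<Sum>M\<in>X. \<psi> (g ** M)) = (\<Sum>M\<in>X. \<psi> M)"
    unfolding X_def
    by (rule sum_image_reduce_translate[OF assms(1,3)]) (simp add: \<psi>_def \<zeta>_cong \<phi>_cong cong: if_cong)
  then have "(\<Sum>M\<in>X. if \<zeta> M = 1 then 0 else \<phi> M) = 0"
    unfolding cobound[symmetric] by (simp add: sum_subtractf)
  moreover have "(\<Sum>M\<in>X. \<phi> M) = (\<Sum>M\<in>X. if \<zeta> M = 1 then 0 else \<phi> M) + (\<Sum>M\<in>X. if \<zeta> M = 1 then \<phi> M else 0)"
    by (simp add: sum.distrib[symmetric] if_distrib cong: if_cong)
  moreover have "(\<Sum>M\<in>X. if \<zeta> M = 1 then \<phi> M else 0) = (\<Sum>M\<in>{M\<in>X. int q dvd w M}. \<phi> M)"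
    using finite_image_reduce[OF assms(2), of \<Gamma>]
    by (simp add: X_def \<zeta>_def ee_divide_eq_1_iff[OF assms(2)] sum.inter_filter)
  ultimately show ?thesis
    by (simp add: weyl_sum_def X_def L_def \<phi>_def w_def)
qed

section \<open>Local energies\<close>

lemma prime_power_dvd_mult_cases:
  fixes p x y :: int
  assumes "prime p" "p ^ j dvd x * y" "\<not> (p dvd x \<and> p dvd y)"
  shows "p ^ j dvd x \<or> p ^ j dvd y"
proof (cases "p dvd x")
  case True
  then have "coprime (p ^ j) y"
    using assms by (simp add: prime_imp_coprime)
  then show ?thesis using assms(2) by (simp add: coprime_dvd_mult_left_iff)
next
  case False
  then have "coprime (p ^ j) x"
    using assms by (simp add: prime_imp_coprime)
  then show ?thesis using assms(2) by (simp add: coprime_dvd_mult_right_iff)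
qed

lemma prime_power_dvd_mult_split:
  fixes p x y :: int
  assumes "prime p" "p ^ l dvd x * y"
  obtains i where "i \<le> l" "p ^ i dvd x" "p ^ (l - i) dvd y"
proof -
  obtain i j where "i + j = l" "p ^ i dvd x" "p ^ j dvd y"
    using prime_elem_power_dvd_prod[OF assms(2)] assms(1) by blast
  then show ?thesis using that[of i] by auto
qed

lemma card_residue_class_le:
  fixes d m a :: int
  assumes "d > 0" "m > 0"
  shows "card {x \<in> {0..<d * m}. d dvd x - a} \<le> nat m"
proof -
  have "inj_on (\<lambda>x. x div d) {x \<in> {0..<d * m}. d dvd x - a}"
  proof (rule inj_onI)
    fix x y assume "x \<in> {x \<in> {0..<d * m}. d dvd x - a}" "y \<in> {x \<in> {0..<d * m}. d dvd x - a}"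
      and xy: "x div d = y div d"
    then have "x mod d = a mod d" "y mod d = a mod d" by (auto simp: mod_eq_dvd_iff)
    then show "x = y" using xy div_mult_mod_eq[of x d] div_mult_mod_eq[of y d] by simp
  qed
  moreover have "(\<lambda>x. x div d) ` {x \<in> {0..<d * m}. d dvd x - a} \<subseteq> {0..<m}"
  proof clarify
    fix x assume x: "x \<in> {0..<d * m}"
    have "d * (x div d) \<le> x"
      using assms(1) mult_div_mod_eq[of d x] pos_mod_sign[of d x] by linarith
    also have "x < d * m" using x by simp
    finally show "x div d \<in> {0..<m}"
      using x assms(1) by (simp add: pos_imp_zdiv_nonneg_iff)
  qed
  ultimately show ?thesis
    using card_inj_on_le[of "\<lambda>x. x div d" _ "{0..<m}"] by simp
qed

lemma card_residue_class_power_le: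
  fixes p l j :: nat and a :: int
  assumes "p > 0" "j \<le> l"
  shows "card {x \<in> {0..<int p ^ l}. int p ^ j dvd x - a} \<le> p ^ (l - j)"
  using card_residue_class_le[of "int p ^ j" "int p ^ (l - j)" a] assms
  by (simp add: power_add[symmetric] nat_power_eq)

lemma card_square_roots_le:
  fixes p l j :: nat and \<Delta> :: int
  assumes "prime p" "p \<noteq> 2" "j \<le> l"
  shows "card {x \<in> {0..<int p ^ l}. \<not> int p dvd x \<and> int p ^ j dvd x * x - \<Delta>} \<le> 2 * p ^ (l - j)"
proof (cases "{x \<in> {0..<int p ^ l}. \<not> int p dvd x \<and> int p ^ j dvd x * x - \<Delta>} = {}")
  case False
  then obtain y where y: "\<not> int p dvd y" "int p ^ j dvd y * y - \<Delta>" by blast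
  have p: "prime (int p)" "p > 0" using assms(1) by (simp_all add: prime_gt_0_nat)
  have "\<not> int p dvd 2"
    using assms(1,2) by (metis int_dvd_int_iff of_nat_numeral primes_dvd_imp_eq two_is_prime_nat)
  then have 2: "\<not> int p dvd 2 * y" using y(1) p(1) by (simp add: prime_dvd_mult_iff)
  have "{x \<in> {0..<int p ^ l}. \<not> int p dvd x \<and> int p ^ j dvd x * x - \<Delta>} \<subseteq>
      {x \<in> {0..<int p ^ l}. int p ^ j dvd x - y} \<union> {x \<in> {0..<int p ^ l}. int p ^ j dvd x - (- y)}"
  proof
    fix x assume x: "x \<in> {x \<in> {0..<int p ^ l}. \<not> int p dvd x \<and> int p ^ j dvd x * x - \<Delta>}"
    then have "int p ^ j dvd (x * x - \<Delta>) - (y * y - \<Delta>)"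
      using dvd_diff[OF _ y(2)] by blast
    then have "int p ^ j dvd (x - y) * (x + y)"
      by (simp add: algebra_simps)
    moreover have "\<not> (int p dvd x - y \<and> int p dvd x + y)"
      using 2 dvd_diff[of "int p" "x + y" "x - y"] by auto
    ultimately show "x \<in> {x \<in> {0..<int p ^ l}. int p ^ j dvd x - y} \<union> {x \<in> {0..<int p ^ l}. int p ^ j dvd x - (- y)}"
      using prime_power_dvd_mult_cases[OF p(1)] x by auto
  qed
  then have "card {x \<in> {0..<int p ^ l}. \<not> int p dvd x \<and> int p ^ j dvd x * x - \<Delta>}
      \<le> card ({x \<in> {0..<int p ^ l}. int p ^ j dvd x - y} \<union> {x \<in> {0..<int p ^ l}. int p ^ j dvd x - (- y)})"
    by (intro card_mono finite_UnI finite_Collect_conjI) auto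
  also have "\<dots> \<le> card {x \<in> {0..<int p ^ l}. int p ^ j dvd x - y} + card {x \<in> {0..<int p ^ l}. int p ^ j dvd x - (- y)}"
    by (rule card_Un_le)
  also have "\<dots> \<le> p ^ (l - j) + p ^ (l - j)"
    by (intro add_mono card_residue_class_power_le p assms)
  finally show ?thesis by simp
next
  case True
  then show ?thesis by (simp only: card.empty)
qed

definition kloosterman_pairs :: "nat \<Rightarrow> nat \<Rightarrow> int \<Rightarrow> (int \<times> int) set" where
  "kloosterman_pairs p l \<Delta> = {(x, y) \<in> {0..<int p ^ l} \<times> {0..<int p ^ l}.
     \<not> int p dvd x \<and> \<not> int p dvd y \<and> int p ^ l dvd (x - y) * (x * y - \<Delta>)}"

lemma card_kloosterman_pairs_le:
  assumes "prime p" "p \<noteq> 2"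
  shows "card (kloosterman_pairs p l \<Delta>) \<le> 2 * (l + 1) * p ^ l"
proof -
  have p: "prime (int p)" "p > 0" using assms(1) by (simp_all add: prime_gt_0_nat)
  define R where "R = {0..<int p ^ l}"
  define V where "V i = {(x, y) \<in> R \<times> R. \<not> int p dvd x \<and> \<not> int p dvd y \<and>
    int p ^ i dvd x - y \<and> int p ^ (l - i) dvd x * y - \<Delta>}" for i
  have finV: "finite (V i)" for i
    by (rule finite_subset[of _ "R \<times> R"]) (auto simp: V_def R_def)
  have V: "card (V i) \<le> 2 * p ^ l" if "i \<le> l" for i
  proof -
    define j m where "j = min i (l - i)" and "m = max i (l - i)"
    have jm: "j \<le> l" "m \<le> l" "l - j = m" "l - m = j" "j + m = l"
      using that by (auto simp: j_def m_def min_def max_def)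
    define W where "W = {x \<in> R. \<not> int p dvd x \<and> int p ^ j dvd x * x - \<Delta>}"
    have sub: "V i \<subseteq> Sigma W (\<lambda>x. {y. (x, y) \<in> V i})"
    proof (rule subrelI)
      fix x y assume xy: "(x, y) \<in> V i"
      have "int p ^ j dvd x - y" "int p ^ j dvd x * y - \<Delta>"
        using xy dvd_trans[OF le_imp_power_dvd[of j i]] dvd_trans[OF le_imp_power_dvd[of j "l - i"]]
        by (auto simp: V_def j_def)
      then have "int p ^ j dvd (x * y - \<Delta>) + x * (x - y)"
        using dvd_add dvd_mult by blast
      then have "x \<in> W" using xy by (simp add: W_def V_def algebra_simps)
      then show "(x, y) \<in> Sigma W (\<lambda>x. {y. (x, y) \<in> V i})" using xy by simp
    qed
    have fibre: "card {y. (x, y) \<in> V i} \<le> p ^ j" for x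
    proof (cases "{y. (x, y) \<in> V i} = {}")
      case False
      then obtain z where z: "(x, z) \<in> V i" by blast
      have "{y. (x, y) \<in> V i} \<subseteq> {y \<in> R. int p ^ m dvd y - z}"
      proof (rule subsetI)
        fix y assume "y \<in> {y. (x, y) \<in> V i}"
        then have y: "(x, y) \<in> V i" by simp
        have "int p ^ i dvd (x - z) - (x - y)"
          using y z dvd_diff[of "int p ^ i" "x - z" "x - y"] by (auto simp: V_def)
        moreover have "int p ^ (l - i) dvd (x * y - \<Delta>) - (x * z - \<Delta>)"
          using y z dvd_diff[of "int p ^ (l - i)" "x * y - \<Delta>" "x * z - \<Delta>"] by (auto simp: V_def)
        then have "int p ^ (l - i) dvd x * (y - z)"
          by (simp add: algebra_simps)
        moreover have "coprime (int p ^ (l - i)) x"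
          using y p(1) by (simp add: V_def prime_imp_coprime)
        ultimately show "y \<in> {y \<in> R. int p ^ m dvd y - z}"
          using y by (auto simp: V_def m_def max_def coprime_dvd_mult_right_iff)
      qed
      then have "card {y. (x, y) \<in> V i} \<le> card {y \<in> R. int p ^ m dvd y - z}"
        unfolding R_def by (intro card_mono finite_Collect_conjI disjI1) simp_all
      then show ?thesis
        using card_residue_class_power_le[OF p(2) jm(2), of z] jm(4) by (simp add: R_def)
    qed simp
    have fin: "finite W" "finite {y. (x, y) \<in> V i}" for x
    proof -
      show "finite W"
        by (rule finite_subset[of _ R]) (auto simp: W_def R_def)
      show "finite {y. (x, y) \<in> V i}"
        by (rule finite_subset[of _ R]) (auto simp: V_def R_def)
    qed
    have "card (V i) \<le> card (Sigma W (\<lambda>x. {y. (x, y) \<in> V i}))"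
      using fin by (intro card_mono[OF _ sub] finite_SigmaI) auto
    also have "\<dots> = (\<Sum>x\<in>W. card {y. (x, y) \<in> V i})"
      using fin by (intro card_SigmaI) auto
    also have "\<dots> \<le> (\<Sum>x\<in>W. p ^ j)"
      using fibre by (rule sum_mono)
    also have "\<dots> \<le> 2 * p ^ m * p ^ j"
      using card_square_roots_le[OF assms jm(1), of \<Delta>] jm(3) by (simp add: W_def R_def)
    also have "\<dots> = 2 * p ^ l"
      using power_add[of p j m] jm(5) by (simp add: mult_ac)
    finally show ?thesis .
  qed
  have "kloosterman_pairs p l \<Delta> \<subseteq> (\<Union>i\<in>{..l}. V i)"
  proof
    fix z assume z: "z \<in> kloosterman_pairs p l \<Delta>"
    obtain x y where [simp]: "z = (x, y)" by (cases z)
    have "int p ^ l dvd (x - y) * (x * y - \<Delta>)"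
      using z by (simp add: kloosterman_pairs_def)
    then obtain i where "i \<le> l" "int p ^ i dvd x - y" "int p ^ (l - i) dvd x * y - \<Delta>"
      using prime_power_dvd_mult_split[OF p(1)] by blast
    then show "z \<in> (\<Union>i\<in>{..l}. V i)"
      using z by (auto simp: kloosterman_pairs_def V_def R_def)
  qed
  then have "card (kloosterman_pairs p l \<Delta>) \<le> card (\<Union>i\<in>{..l}. V i)"
    using finV by (intro card_mono finite_UN_I) auto
  also have "\<dots> \<le> (\<Sum>i\<in>{..l}. card (V i))"
    by (intro card_UN_le) simp
  also have "\<dots> \<le> (\<Sum>i\<in>{..l}. 2 * p ^ l)"
    using V by (intro sum_mono) auto
  finally show ?thesis by simp
qed

lemma vec22_eq_iff:
  fixes M N :: "'a ^ 2 ^ 2"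
  shows "M = N \<longleftrightarrow> M $ 1 $ 1 = N $ 1 $ 1 \<and> M $ 1 $ 2 = N $ 1 $ 2 \<and> M $ 2 $ 1 = N $ 2 $ 1 \<and> M $ 2 $ 2 = N $ 2 $ 2"
  by (auto simp: vec_eq_iff forall_2)

lemma finite_SL2_mod: "finite (SL2_mod q)"
proof (rule finite_imageD)
  let ?f = "\<lambda>M :: mat2. (M $ 1 $ 1, M $ 1 $ 2, M $ 2 $ 1, M $ 2 $ 2)"
  show "finite (?f ` SL2_mod q)"
    by (rule finite_subset[of _ "{0..<int q} \<times> {0..<int q} \<times> {0..<int q} \<times> {0..<int q}"])
      (auto simp: SL2_mod_def)
  show "inj_on ?f (SL2_mod q)"
    by (auto simp: inj_on_def vec22_eq_iff)
qed

lemma card_SL2_mod_ge: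
  assumes "prime p" "l \<ge> 1"
  shows "(p ^ l) ^ 3 \<le> 2 * card (SL2_mod (p ^ l))"
proof -
  have p: "prime (int p)" "p \<ge> 2" using assms(1) by (simp_all add: prime_ge_2_nat)
  define q where "q = p ^ l"
  have q: "q > 0" using p(2) by (simp add: q_def)
  define R where "R = {0..<int q}"
  define U where "U = {a \<in> R. \<not> int p dvd a}"
  have "\<exists>v. [a * v = 1] (mod int q)" if "a \<in> U" for a
  proof -
    have "coprime (int p) a"
      using that p(1) by (intro prime_imp_coprime) (auto simp: U_def)
    then have "coprime a (int q)"
      by (simp add: q_def coprime_commute)
    then show ?thesis using cong_solve_coprime_int by blast
  qed
  then obtain v where v: "\<And>a. a \<in> U \<Longrightarrow> [a * v a = 1] (mod int q)" by metis
  define f :: "int \<times> int \<times> int \<Rightarrow> mat2" where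
    "f = (\<lambda>(a, b, c). vector [vector [a, b], vector [c, (v a * (1 + b * c)) mod int q]])"
  have inj: "inj_on f (U \<times> R \<times> R)"
    by (auto simp: inj_on_def f_def vec22_eq_iff)
  have sub: "f ` (U \<times> R \<times> R) \<subseteq> SL2_mod q"
  proof clarify
    fix a b c assume abc: "a \<in> U" "b \<in> R" "c \<in> R"
    have "[a * ((v a * (1 + b * c)) mod int q) - b * c = (a * v a) * (1 + b * c) - b * c] (mod int q)"
      by (intro cong_diff cong_refl) (simp add: cong_def mod_mult_right_eq mult.assoc)
    also have "[(a * v a) * (1 + b * c) - b * c = 1 * (1 + b * c) - b * c] (mod int q)"
      by (intro cong_diff cong_refl cong_mult v abc)
    finally have "[det (f (a, b, c)) = 1] (mod int q)"
      by (simp add: f_def det_2)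
    then show "f (a, b, c) \<in> SL2_mod q"
      using abc q by (simp add: SL2_mod_def forall_2 f_def U_def R_def)
  qed
  have "R - U \<subseteq> {a \<in> {0..<int p ^ l}. int p ^ 1 dvd a - 0}"
    by (auto simp: U_def R_def q_def)
  then have "card (R - U) \<le> card {a \<in> {0..<int p ^ l}. int p ^ 1 dvd a - 0}"
    by (intro card_mono finite_Collect_conjI disjI1) simp_all
  also have "\<dots> \<le> p ^ (l - 1)"
    using assms p(2) by (intro card_residue_class_power_le) auto
  finally have "card (R - U) \<le> p ^ (l - 1)" .
  moreover have "card (R - U) = q - card U"
  proof (subst card_Diff_subset)
    show "finite U" unfolding U_def R_def by (intro finite_Collect_conjI disjI1) simp
  qed (auto simp: U_def R_def)
  moreover have "2 * p ^ (l - 1) \<le> p * p ^ (l - 1)"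
    using p(2) by simp
  then have "2 * p ^ (l - 1) \<le> q"
    using assms(2) by (cases l) (auto simp: q_def)
  ultimately have "q \<le> 2 * card U" by linarith
  then have "q * (q * q) \<le> 2 * card U * (q * q)" by (rule mult_le_mono1)
  moreover have "card U * (q * q) = card (U \<times> R \<times> R)"
    by (simp add: card_cartesian_product R_def)
  moreover have "card (U \<times> R \<times> R) \<le> card (SL2_mod q)"
    using card_inj_on_le[OF inj sub finite_SL2_mod] .
  ultimately have "q * (q * q) \<le> 2 * card (SL2_mod q)" by (simp only: mult.assoc)
  then show ?thesis by (simp add: q_def power3_eq_cube mult.assoc)
qed

text \<open>On the support the linear form is a function of \<open>w = A a + B b\<close> alone: \<open>w c \<equiv> - B\<close> and
  \<open>w d \<equiv> A\<close> give \<open>w L \<equiv> w\<^sup>2 + \<Delta>\<close>, which turns the sum into a Kloosterman sum.\<close>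

lemma card_lin_form_pairs_le:
  fixes A B C D :: int
  assumes "prime p" "l \<ge> 1" "\<not> int p dvd A \<or> \<not> int p dvd B"
  defines "q \<equiv> p ^ l"
  defines "Y \<equiv> {M \<in> SL2_mod q. int q dvd A * M $ 2 $ 1 + B * M $ 2 $ 2}"
  shows "card {(M, N) \<in> Y \<times> Y. int q dvd lin_form A B C D M - lin_form A B C D N}
    \<le> q\<^sup>2 * card (kloosterman_pairs p l (A * D - B * C))"
proof -
  have p: "prime (int p)" "p > 0" using assms(1) by (simp_all add: prime_gt_0_nat)
  have q: "q > 0" "int p dvd int q" "int q = int p ^ l"
    using p(2) assms(2) by (auto simp: q_def dvd_power)
  define L where "L = lin_form A B C D"
  define w where "w M = A * M $ 1 $ 1 + B * M $ 1 $ 2" for M :: mat2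
  define t where "t M = (if int p dvd A then M $ 1 $ 1 else M $ 1 $ 2)" for M :: mat2
  have wc: "int q dvd w M * M $ 2 $ 1 + B" and wd: "int q dvd w M * M $ 2 $ 2 - A"
    and wL: "int q dvd w M * L M - ((w M)\<^sup>2 + (A * D - B * C))"
    and w_unit: "\<not> int p dvd w M" if M: "M \<in> Y" for M
  proof -
    define a b c d where abcd: "a = M $ 1 $ 1" "b = M $ 1 $ 2" "c = M $ 2 $ 1" "d = M $ 2 $ 2"
    have d1: "int q dvd a * d - b * c - 1"
      using M by (simp add: Y_def SL2_mod_def det_2 abcd cong_iff_dvd_diff)
    have d2: "int q dvd A * c + B * d"
      using M by (simp add: Y_def abcd)
    have "int q dvd a * (A * c + B * d) - B * (a * d - b * c - 1)"
      by (intro dvd_diff[OF dvd_mult[OF d2] dvd_mult[OF d1]])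
    then show 1: "int q dvd w M * M $ 2 $ 1 + B"
      by (simp add: w_def abcd[symmetric] algebra_simps)
    have "int q dvd A * (a * d - b * c - 1) + b * (A * c + B * d)"
      by (intro dvd_add[OF dvd_mult[OF d1] dvd_mult[OF d2]])
    then show 2: "int q dvd w M * M $ 2 $ 2 - A"
      by (simp add: w_def abcd[symmetric] algebra_simps)
    have "int q dvd C * (w M * M $ 2 $ 1 + B) + D * (w M * M $ 2 $ 2 - A)"
      by (intro dvd_add[OF dvd_mult[OF 1] dvd_mult[OF 2]])
    moreover have "w M * L M - ((w M)\<^sup>2 + (A * D - B * C))
        = C * (w M * M $ 2 $ 1 + B) + D * (w M * M $ 2 $ 2 - A)"
      by (simp add: L_def lin_form_def w_def algebra_simps power2_eq_square)
    ultimately show "int q dvd w M * L M - ((w M)\<^sup>2 + (A * D - B * C))" by simp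
    show "\<not> int p dvd w M"
    proof
      assume "int p dvd w M"
      then have "int p dvd w M * M $ 2 $ 1" "int p dvd w M * M $ 2 $ 2" by simp_all
      moreover have "int p dvd w M * M $ 2 $ 1 + B" "int p dvd w M * M $ 2 $ 2 - A"
        using 1 2 q(2) dvd_trans by blast+
      ultimately have "int p dvd B" "int p dvd A"
        using dvd_add_right_iff dvd_diff_right_iff by blast+
      then show False using assms(3) by simp
    qed
  qed
  have coprime_q: "coprime (int q) x" if "\<not> int p dvd x" for x
    using that p(1) by (simp add: q(3) prime_imp_coprime)
  have Y_eqI: "M = N" if MN: "M \<in> Y" "N \<in> Y" "int q dvd w M - w N" "t M = t N" for M N
  proof -
    have entries: "M $ i $ j = N $ i $ j" if "int q dvd x * (M $ i $ j - N $ i $ j)" "\<not> int p dvd x" for i j x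
    proof -
      have "int q dvd M $ i $ j - N $ i $ j"
        using that coprime_q by (simp add: coprime_dvd_mult_right_iff)
      then have "M $ i $ j mod int q = N $ i $ j mod int q" by (simp add: mod_eq_dvd_iff)
      then show ?thesis using MN(1,2) by (simp add: Y_def SL2_mod_def)
    qed
    have "int q dvd (w M * M $ 2 $ 1 + B) - (w N * N $ 2 $ 1 + B) - (w M - w N) * N $ 2 $ 1"
      by (rule dvd_diff[OF dvd_diff[OF wc[OF MN(1)] wc[OF MN(2)]] dvd_mult2[OF MN(3)]])
    then have c: "M $ 2 $ 1 = N $ 2 $ 1"
      by (intro entries[OF _ w_unit[OF MN(1)]]) (simp add: algebra_simps)
    have "int q dvd (w M * M $ 2 $ 2 - A) - (w N * N $ 2 $ 2 - A) - (w M - w N) * N $ 2 $ 2"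
      by (rule dvd_diff[OF dvd_diff[OF wd[OF MN(1)] wd[OF MN(2)]] dvd_mult2[OF MN(3)]])
    then have d: "M $ 2 $ 2 = N $ 2 $ 2"
      by (intro entries[OF _ w_unit[OF MN(1)]]) (simp add: algebra_simps)
    have "M $ 1 $ 1 = N $ 1 $ 1 \<and> M $ 1 $ 2 = N $ 1 $ 2"
    proof (cases "int p dvd A")
      case True
      then have "M $ 1 $ 1 = N $ 1 $ 1" using MN(4) by (simp add: t_def)
      moreover from this have "M $ 1 $ 2 = N $ 1 $ 2"
        using MN(3) assms(3) True by (intro entries[of B]) (auto simp: w_def algebra_simps)
      ultimately show ?thesis by simp
    next
      case False
      then have "M $ 1 $ 2 = N $ 1 $ 2" using MN(4) by (simp add: t_def)
      moreover from this have "M $ 1 $ 1 = N $ 1 $ 1"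
        using MN(3) False by (intro entries[of A]) (auto simp: w_def algebra_simps)
      ultimately show ?thesis by simp
    qed
    then show ?thesis using c d by (simp add: vec22_eq_iff)
  qed
  define f where "f = (\<lambda>(M, N). ((t M, t N), (w M mod int q, w N mod int q)))"
  define Q where "Q = {(M, N) \<in> Y \<times> Y. int q dvd L M - L N}"
  have inj: "inj_on f Q"
  proof (rule inj_onI)
    fix z z' assume z: "z \<in> Q" "z' \<in> Q" "f z = f z'"
    obtain M N M' N' where [simp]: "z = (M, N)" "z' = (M', N')" by (cases z, cases z')
    have "M = M'" "N = N'"
      using z by (auto simp: Q_def f_def mod_eq_dvd_iff intro: Y_eqI)
    then show "z = z'" by simp
  qed
  have range: "f ` Q \<subseteq> ({0..<int q} \<times> {0..<int q}) \<times> kloosterman_pairs p l (A * D - B * C)"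
  proof (rule image_subsetI)
    fix z assume "z \<in> Q"
    then obtain M N where z: "z = (M, N)" "M \<in> Y" "N \<in> Y" "int q dvd L M - L N"
      by (auto simp: Q_def)
    have t: "t M \<in> {0..<int q}" if "M \<in> Y" for M
      using that by (simp add: t_def Y_def SL2_mod_def)
    define x y where "x = w M mod int q" and "y = w N mod int q"
    have xy: "[x = w M] (mod int q)" "[y = w N] (mod int q)"
      by (simp_all add: x_def y_def cong_def)
    have "\<not> int p dvd x" "\<not> int p dvd y"
      using w_unit[OF z(2)] w_unit[OF z(3)] q(2) by (simp_all add: x_def y_def dvd_mod_iff)
    moreover have "int q dvd (w M - w N) * (w M * w N - (A * D - B * C))"
    proof -
      have "int q dvd w M * w N * (L M - L N)
          - w N * (w M * L M - ((w M)\<^sup>2 + (A * D - B * C))) + w M * (w N * L N - ((w N)\<^sup>2 + (A * D - B * C)))"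
        by (rule dvd_add[OF dvd_diff[OF dvd_mult[OF z(4)] dvd_mult[OF wL[OF z(2)]]] dvd_mult[OF wL[OF z(3)]]])
      also have "\<dots> = (w M - w N) * (w M * w N - (A * D - B * C))"
        by (simp add: algebra_simps power2_eq_square)
      finally show ?thesis .
    qed
    moreover have "[(x - y) * (x * y - (A * D - B * C)) = (w M - w N) * (w M * w N - (A * D - B * C))] (mod int q)"
      by (intro cong_mult cong_diff cong_refl xy)
    ultimately have "(x, y) \<in> kloosterman_pairs p l (A * D - B * C)"
      using q by (auto simp: kloosterman_pairs_def x_def y_def cong_dvd_iff)
    then show "f z \<in> ({0..<int q} \<times> {0..<int q}) \<times> kloosterman_pairs p l (A * D - B * C)"
      using t z by (simp add: f_def x_def y_def)
  qed
  have "finite (kloosterman_pairs p l (A * D - B * C))"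
    by (rule finite_subset[of _ "{0..<int p ^ l} \<times> {0..<int p ^ l}"]) (auto simp: kloosterman_pairs_def)
  then have "card Q \<le> card (({0..<int q} \<times> {0..<int q}) \<times> kloosterman_pairs p l (A * D - B * C))"
    by (intro card_inj_on_le[OF inj range]) simp
  then show ?thesis
    by (simp add: Q_def L_def card_cartesian_product power2_eq_square)
qed

lemma SL2_mod_lift:
  assumes "reduce q ` \<Gamma> = SL2_mod q" "q > 0" "det M = 1"
  obtains g where "g \<in> \<Gamma>" "mat_cong q g M"
proof -
  have "[det (reduce q M) = det M] (mod int q)"
    unfolding det_2 by (intro cong_diff cong_mult) (simp_all add: reduce_def cong_def)
  then have "reduce q M \<in> SL2_mod q"
    using assms(2,3) by (simp add: SL2_mod_def reduce_def)
  then obtain g where "g \<in> \<Gamma>" "reduce q M = reduce q g"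
    using assms(1) by auto
  then show ?thesis using that by (simp add: mat_cong_iff_reduce)
qed

lemma weyl_energy_good_first_row:
  assumes "subgroup \<Gamma> SL2Z" "prime p" "p \<noteq> 2" "l \<ge> 1"
    and surj: "reduce (p ^ l) ` \<Gamma> = SL2_mod (p ^ l)"
    and AB: "\<not> int p dvd A \<or> \<not> int p dvd B"
  shows "weyl_energy \<Gamma> (lin_form A B C D) (p ^ l) * (real (p ^ l))\<^sup>2 \<le> 8 * (real l + 1)"
proof -
  define q where "q = p ^ l"
  define L where "L = lin_form A B C D"
  define c where "c = real (card (SL2_mod q))"
  define Y where "Y = {M \<in> SL2_mod q. int q dvd A * M $ 2 $ 1 + B * M $ 2 $ 2}"
  have q: "q > 0" using assms(2) by (simp add: q_def prime_gt_0_nat)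
  have "real (q ^ 3) \<le> real (2 * card (SL2_mod q))"
    using card_SL2_mod_ge[OF assms(2,4)] unfolding q_def of_nat_le_iff .
  then have c: "real q ^ 3 \<le> 2 * c" by (simp add: c_def)
  have "0 < real q ^ 3" using q by simp
  then have "c > 0" using c by linarith
  define u :: mat2 where "u = vector [vector [1, 1], vector [0, 1]]"
  have "det u = 1" by (simp add: u_def det_2)
  then obtain g where g: "g \<in> \<Gamma>" "mat_cong q g u"
    using SL2_mod_lift[OF surj] q by (auto simp: q_def)
  have "norm (weyl_avg \<Gamma> L q (int r)) = norm (weyl_sum Y L q (int r)) / c" if "coprime r q" for r
  proof -
    have "{M \<in> SL2_mod q. int q dvd int r * 1 * (A * M $ 2 $ 1 + B * M $ 2 $ 2)} = Y"
      using that by (simp add: Y_def coprime_dvd_mult_right_iff coprime_commute)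
    then show ?thesis
      using weyl_sum_support[OF assms(1) q g(1), of 1 A B C D "int r"] g(2) surj
      by (simp add: weyl_avg_def u_def q_def L_def c_def norm_divide)
  qed
  then have "weyl_energy \<Gamma> L q = (\<Sum>r | r < q \<and> coprime r q. (norm (weyl_sum Y L q (int r)))\<^sup>2) / c\<^sup>2"
    by (simp add: weyl_energy_def power_divide sum_divide_distrib)
  also have "\<dots> \<le> (\<Sum>r<q. (norm (weyl_sum Y L q (int r)))\<^sup>2) / c\<^sup>2"
    by (intro divide_right_mono sum_mono2) auto
  also have "(\<Sum>r<q. (norm (weyl_sum Y L q (int r)))\<^sup>2)
      = real q * real (card {(M, N) \<in> Y \<times> Y. int q dvd L M - L N})"
    unfolding weyl_sum_def using q finite_SL2_mod[of q] by (intro parseval_residues) (auto simp: Y_def)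
  finally have "weyl_energy \<Gamma> L q * c\<^sup>2 \<le> real q * real (card {(M, N) \<in> Y \<times> Y. int q dvd L M - L N})"
    using \<open>c > 0\<close> by (simp add: pos_le_divide_eq)
  also have "\<dots> \<le> real q * real (q\<^sup>2 * (2 * (l + 1) * q))"
  proof -
    have "card {(M, N) \<in> Y \<times> Y. int q dvd L M - L N} \<le> q\<^sup>2 * card (kloosterman_pairs p l (A * D - B * C))"
      using card_lin_form_pairs_le[OF assms(2,4) AB, of C D] by (simp add: Y_def L_def q_def)
    also have "\<dots> \<le> q\<^sup>2 * (2 * (l + 1) * q)"
      unfolding q_def by (intro mult_left_mono card_kloosterman_pairs_le assms) auto
    finally show ?thesis by (intro mult_left_mono of_nat_mono) simp_all
  qed
  also have "\<dots> = 2 * (real l + 1) * real q ^ 4"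
    by (simp add: power2_eq_square power4_eq_xxxx distrib_left distrib_right mult_ac)
  finally have 1: "weyl_energy \<Gamma> L q * c\<^sup>2 \<le> 2 * (real l + 1) * real q ^ 4" .
  have "(real q ^ 3)\<^sup>2 \<le> (2 * c)\<^sup>2"
    using c by (intro power_mono) auto
  then have "weyl_energy \<Gamma> L q * (real q ^ 3)\<^sup>2 \<le> weyl_energy \<Gamma> L q * (2 * c)\<^sup>2"
    by (intro mult_left_mono weyl_energy_nonneg)
  also have "\<dots> \<le> 4 * (2 * (real l + 1) * real q ^ 4)"
    using 1 by (simp add: power_mult_distrib)
  finally have "(weyl_energy \<Gamma> L q * (real q)\<^sup>2) * real q ^ 4 \<le> (8 * (real l + 1)) * real q ^ 4"
    by (simp add: power2_eq_square power3_eq_cube power4_eq_xxxx mult_ac)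
  then show ?thesis
    using q by (simp add: q_def L_def)
qed

lemma weyl_energy_good:
  assumes "subgroup \<Gamma> SL2Z" "prime p" "p \<noteq> 2" "l \<ge> 1"
    and surj: "reduce (p ^ l) ` \<Gamma> = SL2_mod (p ^ l)"
    and prim: "Gcd {A, B, C, D} = 1"
  shows "weyl_energy \<Gamma> (lin_form A B C D) (p ^ l) * (real (p ^ l))\<^sup>2 \<le> 8 * (real l + 1)"
proof (cases "\<not> int p dvd A \<or> \<not> int p dvd B")
  case True
  then show ?thesis using weyl_energy_good_first_row assms by blast
next
  case False
  have CD: "\<not> int p dvd - C \<or> \<not> int p dvd - D"
  proof (rule ccontr)
    assume "\<not> ?thesis"
    then have "int p dvd Gcd {A, B, C, D}"
      using False by (intro Gcd_greatest) auto
    then show False using assms(2) unfolding prim by auto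
  qed
  define u :: mat2 where "u = vector [vector [0, 1], vector [- 1, 0]]"
  have q: "p ^ l > 0" using assms(2) by (simp add: prime_gt_0_nat)
  have "det u = 1" by (simp add: u_def det_2)
  then obtain g where g: "g \<in> \<Gamma>" "mat_cong (p ^ l) g u"
    using SL2_mod_lift[OF surj q] by blast
  have "weyl_sum (reduce (p ^ l) ` \<Gamma>) (lin_form A B C D) (p ^ l) r
      = weyl_sum (reduce (p ^ l) ` \<Gamma>) (lin_form (- C) (- D) A B) (p ^ l) r" for r
  proof -
    have "weyl_sum (reduce (p ^ l) ` \<Gamma>) (lin_form A B C D) (p ^ l) r
        = (\<Sum>M\<in>reduce (p ^ l) ` \<Gamma>. ee (of_int (r * lin_form A B C D (g ** M)) / of_nat (p ^ l)))"
      unfolding weyl_sum_def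
      by (rule sum_image_reduce_translate[OF assms(1) g(1), symmetric]) (rule ee_lin_form_cong[OF q _ cong_refl])
    also have "\<dots> = weyl_sum (reduce (p ^ l) ` \<Gamma>) (lin_form (- C) (- D) A B) (p ^ l) r"
      unfolding weyl_sum_def
    proof (rule sum.cong[OF refl])
      fix M
      have "lin_form A B C D (u ** M) = lin_form (- C) (- D) A B M"
        by (simp add: lin_form_def u_def matrix_matrix_mult_def sum_2)
      moreover have "mat_cong (p ^ l) (g ** M) (u ** M)"
        by (intro mat_cong_mult g mat_cong_refl)
      ultimately show "ee (of_int (r * lin_form A B C D (g ** M)) / of_nat (p ^ l))
          = ee (of_int (r * lin_form (- C) (- D) A B M) / of_nat (p ^ l))"
        using ee_lin_form_cong[OF q, of "g ** M" "u ** M" r r A B C D] by simp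
    qed
    finally show ?thesis .
  qed
  then have "weyl_energy \<Gamma> (lin_form A B C D) (p ^ l) = weyl_energy \<Gamma> (lin_form (- C) (- D) A B) (p ^ l)"
    by (simp add: weyl_energy_def weyl_avg_def)
  then show ?thesis
    using weyl_energy_good_first_row[OF assms(1-5) CD, of A B] by simp
qed

lemma weyl_energy_bad_eq_0:
  fixes P B :: int
  assumes "subgroup \<Gamma> SL2Z" "prime p" "P \<noteq> 0"
    and par: "vector [vector [1, P], vector [0, 1]] \<in> \<Gamma>"
    and triv: "\<And>\<gamma>. \<gamma> \<in> \<Gamma> \<Longrightarrow> mat_cong (p ^ k) \<gamma> (mat 1)"
    and B: "\<not> int p ^ k dvd B"
    and l: "l \<ge> k + multiplicity (int p) P"
  shows "weyl_energy \<Gamma> (lin_form A B C D) (p ^ l) = 0"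
proof -
  have p: "prime (int p)" "p > 0" using assms(2) by (simp_all add: prime_gt_0_nat)
  have "weyl_avg \<Gamma> (lin_form A B C D) (p ^ l) (int r) = 0" if r: "coprime r (p ^ l)" for r
  proof -
    have empty: "{M \<in> reduce (p ^ l) ` \<Gamma>. int (p ^ l) dvd int r * P * (A * M $ 2 $ 1 + B * M $ 2 $ 2)} = {}"
    proof (rule ccontr)
      assume "\<not> ?thesis"
      then obtain \<gamma> M where \<gamma>: "\<gamma> \<in> \<Gamma>" "M = reduce (p ^ l) \<gamma>"
        and M: "int (p ^ l) dvd int r * P * (A * M $ 2 $ 1 + B * M $ 2 $ 2)" by blast
      define X where "X = A * M $ 2 $ 1 + B * M $ 2 $ 2"
      define v where "v = multiplicity (int p) P"
      have "\<not> is_unit (int p)" using p(1) by auto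
      then obtain P' where P': "P = int p ^ v * P'" "\<not> int p dvd P'"
        unfolding v_def using multiplicity_decompose'[OF assms(3)] by blast
      have "coprime (int (p ^ l)) (int r)"
        using coprime_int_iff[of "p ^ l" r] r by (simp only: coprime_commute[of r])
      moreover have "int (p ^ l) dvd int r * (P * X)"
        using M by (simp only: X_def mult.assoc)
      ultimately have "int (p ^ l) dvd P * X"
        by (simp only: coprime_dvd_mult_right_iff)
      moreover have "int (p ^ l) = int p ^ v * int p ^ (l - v)"
        using l by (simp add: v_def power_add[symmetric])
      ultimately have "int p ^ v * int p ^ (l - v) dvd int p ^ v * (P' * X)"
        by (simp only: P'(1) mult.assoc)
      then have "int p ^ (l - v) dvd P' * X"
        using p(2) by simp
      then have "int p ^ (l - v) dvd X"
        using P'(2) p(1) by (simp add: coprime_dvd_mult_right_iff prime_imp_coprime)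
      then have "int p ^ k dvd X"
        using dvd_trans[OF le_imp_power_dvd[of k "l - v" "int p"]] l by (simp add: v_def)
      moreover have "mat_cong (p ^ k) M (mat 1)"
      proof (rule mat_cong_trans[OF _ triv[OF \<gamma>(1)]])
        have "p ^ k dvd p ^ l" using l by (intro le_imp_power_dvd) simp
        then show "mat_cong (p ^ k) M \<gamma>"
          unfolding \<gamma>(2) by (rule mat_cong_dvd[OF mat_cong_reduce])
      qed
      then have entry: "[M $ i $ j = mat 1 $ i $ j] (mod int p ^ k)" for i j
        by (simp add: mat_cong_def)
      have "[M $ 2 $ 1 = 0] (mod int p ^ k)" "[M $ 2 $ 2 = 1] (mod int p ^ k)"
        using entry[of 2 1] entry[of 2 2] by (simp_all add: mat_def)
      then have "[X = A * 0 + B * 1] (mod int p ^ k)"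
        unfolding X_def by (intro cong_add cong_mult cong_refl)
      ultimately show False using B by (simp add: cong_dvd_iff)
    qed
    have "p ^ l > 0" using p(2) by simp
    from weyl_sum_support[OF assms(1) this par mat_cong_refl, of A B C D "int r"]
    show ?thesis
      unfolding empty weyl_avg_def by (simp add: weyl_sum_def)
  qed
  then show ?thesis by (simp add: weyl_energy_def)
qed

section \<open>Summation over the moduli\<close>

lemma submultiplicative_bound:
  fixes T :: "nat \<Rightarrow> real" and C \<epsilon> :: real
  assumes nonneg: "\<And>q. 0 \<le> T q" and one: "T 1 \<le> 1"
    and submult: "\<And>a b. a > 0 \<Longrightarrow> b > 0 \<Longrightarrow> coprime a b \<Longrightarrow> T (a * b) \<le> T a * T b"
    and pp: "\<And>p l. prime p \<Longrightarrow> l \<ge> 1 \<Longrightarrow> T (p ^ l) * (real (p ^ l))\<^sup>2 \<le> C * (real l + 1)"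
    and C: "C \<ge> 1" and \<epsilon>: "\<epsilon> > 0"
  obtains K where "K > 0" "\<And>q. q > 0 \<Longrightarrow> T q * (real q)\<^sup>2 \<le> K * real q powr \<epsilon>"
proof -
  define G where "G q = T q * (real q)\<^sup>2 / real q powr \<epsilon>" for q
  define x where "x = 2 powr \<epsilon> - 1"
  define B where "B = C * max 1 (1 / x)"
  define S where "S = {p :: nat. prime p \<and> real p < (2 * C) powr (1 / \<epsilon>)}"
  have x: "x > 0" using \<epsilon> by (simp add: x_def)
  have B: "B \<ge> 1" using C by (simp add: B_def mult_ge1_I)
  have finS: "finite S"
  proof (rule finite_subset)
    show "S \<subseteq> {..nat \<lceil>(2 * C) powr (1 / \<epsilon>)\<rceil>}"
      by (auto simp: S_def) linarith
  qed simp
  have G_nonneg: "G q \<ge> 0" for q using nonneg by (simp add: G_def)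
  have G_mult: "G (a * b) \<le> G a * G b" if "a > 0" "b > 0" "coprime a b" for a b
  proof -
    have "G a * G b = (T a * T b) * (real (a * b))\<^sup>2 / real (a * b) powr \<epsilon>"
      by (simp add: G_def powr_mult power_mult_distrib)
    moreover have "G (a * b) \<le> (T a * T b) * (real (a * b))\<^sup>2 / real (a * b) powr \<epsilon>"
      unfolding G_def by (intro divide_right_mono mult_right_mono submult that) auto
    ultimately show ?thesis by simp
  qed
  have G_pp: "G (p ^ l) \<le> (if p \<in> S then B else 1)" if p: "prime p" and l: "l \<ge> 1" for p l
  proof -
    have p2: "p \<ge> 2" using p by (rule prime_ge_2_nat)
    have powr_pow: "real (p ^ l) powr \<epsilon> = (real p powr \<epsilon>) ^ l"
      using p2 by (simp add: powr_realpow[symmetric] powr_powr mult.commute)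
    have pos: "0 < (real p powr \<epsilon>) ^ l" using p2 by simp
    have G_le: "G (p ^ l) \<le> C * (real l + 1) / (real p powr \<epsilon>) ^ l"
      unfolding G_def powr_pow by (intro divide_right_mono pp p l) simp
    show ?thesis
    proof (cases "p \<in> S")
      case True
      have "1 + real l * x \<le> (1 + x) ^ l"
        using x by (intro Bernoulli_inequality) auto
      also have "\<dots> \<le> (real p powr \<epsilon>) ^ l"
        unfolding x_def using p2 \<epsilon> by (intro power_mono) (auto intro: powr_mono2)
      finally have low: "1 + real l * x \<le> (real p powr \<epsilon>) ^ l" .
      have "1 \<le> max 1 (1 / x)" "1 \<le> max 1 (1 / x) * x"
        using x by (auto simp: max_def field_simps)
      then have "real l + 1 \<le> max 1 (1 / x) + (max 1 (1 / x) * x) * real l"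
        using mult_right_mono[of 1 "max 1 (1 / x) * x" "real l"] by auto
      also have "\<dots> = max 1 (1 / x) * (1 + real l * x)"
        by (simp add: algebra_simps)
      also have "\<dots> \<le> max 1 (1 / x) * (real p powr \<epsilon>) ^ l"
        using low by (intro mult_left_mono) auto
      finally have "C * (real l + 1) \<le> B * (real p powr \<epsilon>) ^ l"
        using C by (simp add: B_def mult.assoc)
      then show ?thesis
        using G_le True pos by (simp add: pos_divide_le_eq[symmetric])
    next
      case False
      have "2 * C = ((2 * C) powr (1 / \<epsilon>)) powr \<epsilon>"
        using C \<epsilon> by (simp add: powr_powr)
      also have "\<dots> \<le> real p powr \<epsilon>"
        using False p \<epsilon> by (intro powr_mono2) (auto simp: S_def)
      finally have "(2 * C) ^ l \<le> (real p powr \<epsilon>) ^ l"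
        using C by (intro power_mono) auto
      moreover have "C * (real l + 1) \<le> (2 * C) ^ l"
      proof -
        have "real l + 1 \<le> 2 ^ l"
          using Bernoulli_inequality[of 1 l] by (simp add: add.commute)
        moreover have "C \<le> C ^ l"
          using C l self_le_power by force
        ultimately have "C * (real l + 1) \<le> C ^ l * 2 ^ l"
          using C by (intro mult_mono) auto
        then show ?thesis by (simp add: power_mult_distrib mult.commute)
      qed
      ultimately show ?thesis
        using G_le False pos by (simp add: pos_divide_le_eq[symmetric])
          (meson divide_le_eq_1_pos dual_order.trans)
    qed
  qed
  have G_le: "G q \<le> B ^ card {p \<in> S. p dvd q}" if "q > 0" for q
    using that
  proof (induction q rule: less_induct)
    case (less q)
    show ?case
    proof (cases "q = 1")
      case True
      have "G 1 \<le> 1" using one by (simp add: G_def)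
      then show ?thesis using True one_le_power[OF B] order.trans by blast
    next
      case False
      then obtain p where p: "prime p" "p dvd q"
        using prime_factor_nat by blast
      define l where "l = multiplicity p q"
      obtain m where m: "q = p ^ l * m" "\<not> p dvd m"
        unfolding l_def using multiplicity_decompose'[of q p] less.prems p(1)
        by (metis neq0_conv not_prime_unit)
      have l: "l \<ge> 1" using m p(2) by (cases l) auto
      have m0: "m > 0" using less.prems m by (cases m) auto
      have "1 < p ^ l" using p(1) l prime_gt_1_nat[of p] by (intro one_less_power) auto
      then have "m < q" using m(1) m0 by simp
      then have IH: "G m \<le> B ^ card {p \<in> S. p dvd m}" using less.IH m0 by blast
      have "coprime (p ^ l) m"
        using p(1) m(2) by (simp add: prime_imp_coprime)
      then have "G q \<le> G (p ^ l) * G m"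
        unfolding m(1) using m0 prime_gt_0_nat[OF p(1)] by (intro G_mult) auto
      also have "\<dots> \<le> (if p \<in> S then B else 1) * B ^ card {p \<in> S. p dvd m}"
        using G_pp[OF p(1) l] IH B G_nonneg by (intro mult_mono) auto
      also have "\<dots> = B ^ card ((if p \<in> S then {p} else {}) \<union> {p \<in> S. p dvd m})"
        using finS m(2) by (simp add: card_insert_if)
      also have "\<dots> \<le> B ^ card {p \<in> S. p dvd q}"
        using finS m(1) l B p(2) by (intro power_increasing card_mono) auto
      finally show ?thesis .
    qed
  qed
  show ?thesis
  proof (rule that[of "B ^ card S"])
    show "B ^ card S > 0" using B by simp
    fix q :: nat assume q: "q > 0"
    have "G q \<le> B ^ card {p \<in> S. p dvd q}" by (rule G_le[OF q])
    also have "\<dots> \<le> B ^ card S"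
      using finS B by (intro power_increasing card_mono) auto
    finally show "T q * (real q)\<^sup>2 \<le> B ^ card S * real q powr \<epsilon>"
      using q by (simp add: G_def pos_divide_le_eq)
  qed
qed

lemma farey_separated:
  fixes q r q' r' :: nat and m :: int
  assumes "r < q" "coprime r q" "r' < q'" "coprime r' q'" "(q, r) \<noteq> (q', r')"
  shows "1 / (real q * real q') \<le> \<bar>- (real r / real q) - - (real r' / real q') - of_int m\<bar>"
proof -
  define z where "z = int r' * int q - int r * int q' - m * (int q * int q')"
  have pos: "0 < real q * real q'" using assms by simp
  have eq: "- (real r / real q) - - (real r' / real q') - of_int m = of_int z / (real q * real q')"
    using assms by (simp add: z_def field_simps)
  have "z \<noteq> 0"
  proof
    assume "z = 0"
    then have m: "int r' * int q - int r * int q' = m * (int q * int q')" by (simp add: z_def)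
    have "r' * q < q' * q" "r * q' < q * q'" using assms by auto
    then have "int r' * int q < int q * int q'" "int r * int q' < int q * int q'"
      by (metis mult.commute of_nat_less_iff of_nat_mult)+
    moreover have "0 \<le> int r' * int q" "0 \<le> int r * int q'" by simp_all
    ultimately have "\<bar>m * (int q * int q')\<bar> < 1 * (int q * int q')" unfolding m[symmetric] by linarith
    then have "\<bar>m\<bar> * (int q * int q') < 1 * (int q * int q')" by (simp add: abs_mult)
    then have "\<bar>m\<bar> < 1" by (rule mult_right_less_imp_less) simp
    then have "int (r' * q) = int (r * q')" using m by simp
    then have rq: "r' * q = r * q'" by (simp only: of_nat_eq_iff)
    have "q dvd r * q'" "q' dvd r' * q" using rq by (metis dvd_triv_right)+
    then have "q dvd q'" "q' dvd q"
      using assms by (simp_all add: coprime_dvd_mult_right_iff coprime_commute)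
    then have "q = q'" by (rule dvd_antisym)
    then show False using rq assms by simp
  qed
  then have "1 \<le> \<bar>of_int z :: real\<bar>" by linarith
  then show ?thesis
    unfolding eq abs_divide using pos by (simp add: divide_right_mono)
qed

lemma sing_series_large_sieve:
  fixes H N :: real
  assumes "subgroup \<Gamma> SL2Z" "H \<ge> 1" "N \<ge> 0"
  defines "Q \<equiv> {q :: nat. H \<le> real q \<and> real q < 2 * H}"
  shows "(\<Sum>n :: int | \<bar>real_of_int n\<bar> \<le> N. (norm (\<Sum>q\<in>Q. sing_series \<Gamma> A B C D q n))\<^sup>2)
    \<le> (2 * N + 1 + harm (nat \<lfloor>4 * H\<^sup>2\<rfloor>) * (4 * H\<^sup>2)) * (\<Sum>q\<in>Q. weyl_energy \<Gamma> (lin_form A B C D) q)"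
proof -
  define U where "U q = {r. r < q \<and> coprime r q}" for q :: nat
  define S where "S = Sigma Q U"
  define a where "a z = weyl_avg \<Gamma> (lin_form A B C D) (fst z) (int (snd z))" for z :: "nat \<times> nat"
  define \<theta> where "\<theta> z = - (real (snd z) / real (fst z))" for z :: "nat \<times> nat"
  have finQ: "finite Q"
  proof (rule finite_subset)
    show "Q \<subseteq> {..nat \<lceil>2 * H\<rceil>}" by (auto simp: Q_def) linarith
  qed simp
  have finU: "finite (U q)" for q by (simp add: U_def)
  have eq: "(\<Sum>q\<in>Q. sing_series \<Gamma> A B C D q n) = (\<Sum>z\<in>S. a z * ee (of_int n * \<theta> z))" for n
  proof -
    have "(\<Sum>q\<in>Q. sing_series \<Gamma> A B C D q n) = (\<Sum>q\<in>Q. \<Sum>r\<in>U q. a (q, r) * ee (of_int n * \<theta> (q, r)))"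
    proof (rule sum.cong[OF refl])
      fix q assume "q \<in> Q"
      then have "q > 0" using assms(2) by (simp add: Q_def)
      then show "sing_series \<Gamma> A B C D q n = (\<Sum>r\<in>U q. a (q, r) * ee (of_int n * \<theta> (q, r)))"
        by (simp only: sing_series_eq_sum_weyl_avg[OF assms(1)] U_def a_def \<theta>_def fst_conv snd_conv)
    qed
    also have "\<dots> = (\<Sum>z\<in>S. a z * ee (of_int n * \<theta> z))"
      unfolding S_def using finQ finU by (subst sum.Sigma) (auto simp: case_prod_beta)
    finally show ?thesis .
  qed
  have set: "{n :: int. \<bar>real_of_int n\<bar> \<le> N} = {- \<lfloor>N\<rfloor>..\<lfloor>N\<rfloor>}"
    by (auto simp: le_floor_iff abs_le_iff minus_le_iff)
  have sep: "1 / (4 * H\<^sup>2) \<le> \<bar>\<theta> z - \<theta> z' - of_int m\<bar>" if z: "z \<in> S" "z' \<in> S" "z \<noteq> z'" for z z' m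
  proof -
    have q: "H \<le> real (fst z)" "real (fst z) < 2 * H" "H \<le> real (fst z')" "real (fst z') < 2 * H"
      using z by (auto simp: S_def Q_def)
    have "real (fst z) * real (fst z') \<le> (2 * H) * (2 * H)"
      using q by (intro mult_mono) auto
    moreover have "0 < real (fst z) * real (fst z')"
      using q assms(2) by (intro mult_pos_pos) auto
    ultimately have "1 / (4 * H\<^sup>2) \<le> 1 / (real (fst z) * real (fst z'))"
      by (intro divide_left_mono) (auto simp: power2_eq_square)
    also have "\<dots> \<le> \<bar>\<theta> z - \<theta> z' - of_int m\<bar>"
      unfolding \<theta>_def using z by (intro farey_separated) (auto simp: S_def U_def prod_eq_iff)
    finally show ?thesis .
  qed
  have "(\<Sum>n\<in>{- \<lfloor>N\<rfloor>..\<lfloor>N\<rfloor>}. (norm (\<Sum>z\<in>S. a z * ee (of_int n * \<theta> z)))\<^sup>2)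
      \<le> (2 * of_int \<lfloor>N\<rfloor> + 1 + harm (nat \<lfloor>1 / (1 / (4 * H\<^sup>2))\<rfloor>) / (1 / (4 * H\<^sup>2))) * (\<Sum>z\<in>S. (norm (a z))\<^sup>2)"
    using finQ finU assms(2,3) sep by (intro large_sieve_weak) (auto simp: S_def)
  also have "\<dots> \<le> (2 * N + 1 + harm (nat \<lfloor>4 * H\<^sup>2\<rfloor>) * (4 * H\<^sup>2)) * (\<Sum>z\<in>S. (norm (a z))\<^sup>2)"
    by (intro mult_right_mono sum_nonneg) auto
  also have "(\<Sum>z\<in>S. (norm (a z))\<^sup>2) = (\<Sum>q\<in>Q. weyl_energy \<Gamma> (lin_form A B C D) q)"
    using sum.Sigma[of Q U "\<lambda>q r. (norm (a (q, r)))\<^sup>2"] finQ finU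
    by (simp add: S_def weyl_energy_def a_def U_def[abs_def] case_prod_beta)
  finally show ?thesis unfolding eq set .
qed

lemma harm_nat_floor_le:
  assumes "x \<ge> 1"
  shows "harm (nat \<lfloor>x\<rfloor>) \<le> 1 + ln (x :: real)"
proof -
  define n where "n = nat \<lfloor>x\<rfloor>"
  have "1 \<le> \<lfloor>x\<rfloor>" using assms by (simp add: le_floor_iff)
  then have n: "n \<ge> 1" "real n \<le> x" by (auto simp: n_def le_nat_iff)
  have "harm n - ln (real n) \<le> harm 1 - ln (real 1)"
    using n(1) by (intro euler_mascheroni_sequence_decreasing) auto
  moreover have "ln (real n) \<le> ln x" using n by simp
  ultimately show ?thesis by (simp add: n_def[symmetric] harm_def)
qed

theorem theorem3p18:
  fixes \<Gamma> :: "mat2 set" and P A B C D :: int and bad :: "nat set" and k :: "nat \<Rightarrow> nat"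
    and \<epsilon> :: real
  assumes subgrp: "subgroup \<Gamma> SL2Z"
    and dense: "zariski_dense_SL2 \<Gamma>"
    and P_pos: "P > 0"
    and parabolic: "vector [vector [1, P], vector [0, 1]] \<in> \<Gamma>"
    and nonzero: "A \<noteq> 0" "B \<noteq> 0" "C \<noteq> 0" "D \<noteq> 0"
    and primitive: "Gcd {A, B, C, D} = 1"
    and crt: "\<And>q\<^sub>1 q\<^sub>2. q\<^sub>1 > 0 \<Longrightarrow> q\<^sub>2 > 0 \<Longrightarrow> coprime q\<^sub>1 q\<^sub>2 \<Longrightarrow>
      bij_betw (natural_map \<Gamma> q\<^sub>1 q\<^sub>2)
        (carrier (grp \<Gamma> Mod cong_sub \<Gamma> (q\<^sub>1 * q\<^sub>2)))
        (carrier (grp \<Gamma> Mod cong_sub \<Gamma> q\<^sub>1) \<times> carrier (grp \<Gamma> Mod cong_sub \<Gamma> q\<^sub>2))"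
    and bad_finite: "finite bad"
    and bad_prime: "\<And>p. p \<in> bad \<Longrightarrow> prime p"
    and bad_2: "2 \<in> bad"
    and good: "\<And>p l. prime p \<Longrightarrow> p \<notin> bad \<Longrightarrow> l \<ge> 1 \<Longrightarrow> reduce (p ^ l) ` \<Gamma> = SL2_mod (p ^ l)"
    and bad_k_pos: "\<And>p. p \<in> bad \<Longrightarrow> k p \<ge> 1"
    and bad_trivial: "\<And>p \<gamma>. p \<in> bad \<Longrightarrow> \<gamma> \<in> \<Gamma> \<Longrightarrow> mat_cong (p ^ k p) \<gamma> (mat 1)"
    and bad_image: "\<And>p l. p \<in> bad \<Longrightarrow> l > k p \<Longrightarrow>
      reduce (p ^ l) ` \<Gamma> = {M \<in> SL2_mod (p ^ l). mat_cong (p ^ k p) M (mat 1)}"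
    and bad_P: "\<And>p. p \<in> bad \<Longrightarrow> [P = 0] (mod int (p ^ k p))"
    and bad_B: "\<And>p. p \<in> bad \<Longrightarrow> k p > multiplicity (int p) B"
    and Delta: "A * D - B * C \<noteq> 0"
    and eps: "\<epsilon> > 0"
  shows "\<exists>K. \<forall>\<^sub>F H :: real in at_top. \<forall>N :: real. N \<ge> 1 \<longrightarrow>
      (\<Sum>n :: int | \<bar>real_of_int n\<bar> \<le> N.
         (norm (\<Sum>q :: nat | H \<le> real q \<and> real q < 2 * H. sing_series \<Gamma> A B C D q n))\<^sup>2)
      \<le> K * (H powr \<epsilon> * (H + N / H powr (1 / 2)))"
proof -
  define L where "L = lin_form A B C D"
  define l\<^sub>0 where "l\<^sub>0 p = k p + multiplicity (int p) P" for p
  define M where "M = 8 + (\<Sum>p\<in>bad. real (p ^ l\<^sub>0 p) ^ 3)"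
  have M8: "M \<ge> 8" by (simp add: M_def sum_nonneg)
  have pp: "weyl_energy \<Gamma> L (p ^ l) * (real (p ^ l))\<^sup>2 \<le> M * (real l + 1)"
    if p: "prime p" and l: "l \<ge> 1" for p l
  proof (cases "p \<in> bad")
    case False
    then have "weyl_energy \<Gamma> L (p ^ l) * (real (p ^ l))\<^sup>2 \<le> 8 * (real l + 1)"
      unfolding L_def using bad_2 by (intro weyl_energy_good subgrp p l good primitive) auto
    also have "\<dots> \<le> M * (real l + 1)" using M8 by (intro mult_right_mono) auto
    finally show ?thesis .
  next
    case True
    show ?thesis
    proof (cases "l \<ge> l\<^sub>0 p")
      case True
      have "\<not> int p ^ k p dvd B"
      proof
        assume "int p ^ k p dvd B"
        then have "k p \<le> multiplicity (int p) B"
          using nonzero(2) p by (intro multiplicity_geI) auto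
        then show False using bad_B[OF \<open>p \<in> bad\<close>] by simp
      qed
      then have "weyl_energy \<Gamma> L (p ^ l) = 0"
        unfolding L_def using True P_pos bad_trivial[OF \<open>p \<in> bad\<close>]
        by (intro weyl_energy_bad_eq_0[OF subgrp p _ parabolic]) (auto simp: l\<^sub>0_def)
      then show ?thesis using M8 by simp
    next
      case False
      have "weyl_energy \<Gamma> L (p ^ l) * (real (p ^ l))\<^sup>2 \<le> real (p ^ l) * (real (p ^ l))\<^sup>2"
        by (intro mult_right_mono weyl_energy_le) auto
      also have "\<dots> = real (p ^ l) ^ 3" by (simp add: power2_eq_square power3_eq_cube)
      also have "\<dots> \<le> real (p ^ l\<^sub>0 p) ^ 3"
        using False prime_gt_0_nat[OF p] by (intro power_mono of_nat_mono power_increasing) auto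
      also have "\<dots> \<le> (\<Sum>p\<in>bad. real (p ^ l\<^sub>0 p) ^ 3)"
        using bad_finite \<open>p \<in> bad\<close> by (intro member_le_sum) auto
      also have "\<dots> \<le> M" by (simp add: M_def)
      also have "\<dots> \<le> M * (real l + 1)" using M8 by (simp add: mult_le_cancel_left1)
      finally show ?thesis .
    qed
  qed
  define \<eta> where "\<eta> = \<epsilon> / 2"
  have \<eta>: "\<eta> > 0" using eps by (simp add: \<eta>_def)
  obtain K where K: "K > 0" "\<And>q. q > 0 \<Longrightarrow> weyl_energy \<Gamma> L q * (real q)\<^sup>2 \<le> K * real q powr \<eta>"
  proof (rule submultiplicative_bound[of "weyl_energy \<Gamma> L" M \<eta>])
    show "weyl_energy \<Gamma> L 1 \<le> 1" using weyl_energy_le[of \<Gamma> L 1] by simp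
    show "weyl_energy \<Gamma> L (a * b) \<le> weyl_energy \<Gamma> L a * weyl_energy \<Gamma> L b"
      if "a > 0" "b > 0" "coprime a b" for a b
      unfolding L_def by (intro weyl_energy_coprime_le subgrp that crt)
  qed (use pp M8 \<eta> weyl_energy_nonneg in auto)
  define K\<^sub>1 where "K\<^sub>1 = 3 * K * 2 powr \<eta>"
  have energy: "(\<Sum>q :: nat | H \<le> real q \<and> real q < 2 * H. weyl_energy \<Gamma> L q) \<le> K\<^sub>1 * H powr \<eta> / H"
    if H: "H \<ge> 1" for H
  proof -
    define Q where "Q = {q :: nat. H \<le> real q \<and> real q < 2 * H}"
    have "Q \<subseteq> {..<nat \<lceil>2 * H\<rceil>}" by (auto simp: Q_def) linarith
    then have "card Q \<le> nat \<lceil>2 * H\<rceil>"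
      using card_mono[of "{..<nat \<lceil>2 * H\<rceil>}" Q] by simp
    then have cardQ: "real (card Q) \<le> 3 * H" using H by linarith
    have "weyl_energy \<Gamma> L q \<le> K * (2 * H) powr \<eta> / H\<^sup>2" if q: "q \<in> Q" for q
    proof -
      have "weyl_energy \<Gamma> L q * H\<^sup>2 \<le> weyl_energy \<Gamma> L q * (real q)\<^sup>2"
        using q H by (intro mult_left_mono power_mono weyl_energy_nonneg) (auto simp: Q_def)
      also have "\<dots> \<le> K * real q powr \<eta>"
        using q H by (intro K(2)) (auto simp: Q_def)
      also have "\<dots> \<le> K * (2 * H) powr \<eta>"
        using q K(1) \<eta> by (intro mult_left_mono powr_mono2) (auto simp: Q_def)
      finally show ?thesis using H by (simp add: pos_le_divide_eq)
    qed
    then have "(\<Sum>q\<in>Q. weyl_energy \<Gamma> L q) \<le> real (card Q) * (K * (2 * H) powr \<eta> / H\<^sup>2)"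
      using sum_bounded_above by blast
    also have "\<dots> \<le> (3 * H) * (K * (2 * H) powr \<eta> / H\<^sup>2)"
      using cardQ K(1) by (intro mult_right_mono) auto
    also have "\<dots> = K\<^sub>1 * H powr \<eta> / H"
      using H by (simp add: K\<^sub>1_def powr_mult power2_eq_square)
    finally show ?thesis by (simp add: Q_def)
  qed
  have K\<^sub>1: "K\<^sub>1 > 0" using K(1) by (simp add: K\<^sub>1_def)
  have log: "\<forall>\<^sub>F H :: real in at_top. 1 + ln (4 * H\<^sup>2) \<le> H powr \<eta>"
    using \<eta> by real_asymp
  show ?thesis
  proof (intro exI[of _ "4 * K\<^sub>1"] eventually_mono[OF eventually_conj[OF log eventually_ge_at_top[of 1]]] allI impI)
    fix H N :: real
    assume H: "1 + ln (4 * H\<^sup>2) \<le> H powr \<eta> \<and> 1 \<le> H" and N: "N \<ge> 1"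
    have pow: "H powr \<eta> * H powr \<eta> = H powr \<epsilon>"
      by (simp add: powr_add[symmetric] \<eta>_def)
    have "H\<^sup>2 \<ge> 1" using H by simp
    then have harm: "harm (nat \<lfloor>4 * H\<^sup>2\<rfloor>) \<le> H powr \<eta>"
      using harm_nat_floor_le[of "4 * H\<^sup>2"] H by linarith
    have half: "1 / H \<le> 1 / H powr (1 / 2)"
      using H powr_mono[of "1 / 2" 1 H] by (intro divide_left_mono) auto
    have mono: "H powr \<eta> \<le> H powr \<epsilon>"
      using H \<eta> by (intro powr_mono) (auto simp: \<eta>_def)
    have "(\<Sum>n :: int | \<bar>real_of_int n\<bar> \<le> N.
         (norm (\<Sum>q :: nat | H \<le> real q \<and> real q < 2 * H. sing_series \<Gamma> A B C D q n))\<^sup>2)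
      \<le> (2 * N + 1 + harm (nat \<lfloor>4 * H\<^sup>2\<rfloor>) * (4 * H\<^sup>2))
          * (\<Sum>q :: nat | H \<le> real q \<and> real q < 2 * H. weyl_energy \<Gamma> L q)"
      unfolding L_def using H N by (intro sing_series_large_sieve subgrp) auto
    also have "\<dots> \<le> (3 * N + H powr \<eta> * (4 * H\<^sup>2)) * (K\<^sub>1 * H powr \<eta> / H)"
      using H N harm energy[of H]
      by (intro mult_mono add_mono mult_right_mono) (auto intro!: sum_nonneg weyl_energy_nonneg)
    also have "\<dots> = K\<^sub>1 * (3 * (H powr \<eta> * (N * (1 / H))) + 4 * (H powr \<eta> * H powr \<eta> * H))"
      using H by (simp add: field_simps power2_eq_square)
    also have "\<dots> \<le> K\<^sub>1 * (4 * (H powr \<epsilon> * (N * (1 / H powr (1 / 2)))) + 4 * (H powr \<epsilon> * H))"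
      unfolding pow using K\<^sub>1 H N half mono
      by (intro mult_left_mono add_mono mult_mono order.refl) auto
    also have "\<dots> = 4 * K\<^sub>1 * (H powr \<epsilon> * (H + N / H powr (1 / 2)))"
      by (simp add: algebra_simps)
    finally show "(\<Sum>n :: int | \<bar>real_of_int n\<bar> \<le> N.
         (norm (\<Sum>q :: nat | H \<le> real q \<and> real q < 2 * H. sing_series \<Gamma> A B C D q n))\<^sup>2)
      \<le> 4 * K\<^sub>1 * (H powr \<epsilon> * (H + N / H powr (1 / 2)))" .
  qed
qed

end
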